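(* Let $x,y$ be integers with $1<x<y$, let $a,b,c\ge 0$ be integers, and let $L=\{1^a,x^b,y^c\}$ (a multiset of size $v-1$ where $v=a+b+c+1$). Then $L$ has a linear realization in each of the following cases: (1) $a\ge x+y-1$; (2) $a\ge x+y-2$, when $x=3$ or $x$ is even; (3) $a\ge 4x-3$, when $x$ is odd, $y>2x-2$, and $b\ge y-2x+2$; (4) $a\ge x$, when $y=tx$ with $x$ and $t$ odd, and $b\ge tx+2t-3$; (5) $a\ge 7$, when $x=3$ and $b\ge y-4$.
   Context: For a positive integer $v$, $K_v$ is the complete graph on vertex set $\{0,1,\dots,v-1\}$; the linear length of an edge $\{u,w\}$ is $|u-w|$. A multiset $L$ of positive integers of size $v-1$ has a linear realization if there is a Hamiltonian path in $K_v$ whose multiset of linear edge lengths equals $L$. The notation $\{x_1^{a_1},\dots,x_k^{a_k}\}$ denotes the multiset containing $x_i$ with multiplicity $a_i$. *)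

theory Defs
  imports Main "HOL-Library.Multiset"
begin

text \<open>A simple graph is given by its vertex set together with its set of (two-element) edges.\<close>

definition complete_graph :: "nat \<Rightarrow> nat set \<times> nat set set" where
  "complete_graph v = ({0..<v}, {{u, w} | u w. u < v \<and> w < v \<and> u \<noteq> w})"

text \<open>A path is listed by its successive vertices, so its edges join neighbouring list entries.\<close>

definition path_steps :: "'a list \<Rightarrow> ('a \<times> 'a) list" where
  "path_steps p = zip p (tl p)"

definition hamiltonian_path :: "'a set \<times> 'a set set \<Rightarrow> 'a list \<Rightarrow> bool" where
  "hamiltonian_path G p \<longleftrightarrow>
     distinct p \<and> set p = fst G \<and> (\<forall>(u, w) \<in> set (path_steps p). {u, w} \<in> snd G)"

definition linear_length :: "nat \<Rightarrow> nat \<Rightarrow> nat" where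
  "linear_length u w = nat \<bar>int u - int w\<bar>"

definition path_linear_lengths :: "nat list \<Rightarrow> nat multiset" where
  "path_linear_lengths p = mset (map (\<lambda>(u, w). linear_length u w) (path_steps p))"

text \<open>For a multiset of size \<open>v - 1\<close> the host graph is the complete graph on \<open>v = size L + 1\<close>
  vertices. Positivity of the elements of \<open>L\<close> need not be required: edges have positive length.\<close>

definition has_linear_realization :: "nat multiset \<Rightarrow> bool" where
  "has_linear_realization L \<longleftrightarrow>
     (\<exists>p. hamiltonian_path (complete_graph (size L + 1)) p \<and> path_linear_lengths p = L)"

end

theory Submission
  imports Defs
begin

text \<open>Arrange the vertices into columns by their residues modulo \<open>y\<close> and run up and down the columns:
  the vertical edges have length \<open>y\<close>, and the path moves between the columns along a path through the
  residues whose steps have length \<open>1\<close> or \<open>x\<close>. Since the columns have two different heights, the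
  higher ones must be visited first and be even in number, or a single edge must be changed by a Posa
  rotation at the end of the path. Two paths that start at \<open>0\<close> can be joined there, so that a path with
  edges of length \<open>1\<close> and \<open>y\<close> (and a few of length \<open>x\<close>) is combined with one with edges of length
  \<open>1\<close> and \<open>x\<close>. This gives the cases (1) and (2), where all the steps between columns but at most one
  have length \<open>1\<close>, and the cases (3) and (5), where most of them have length \<open>x\<close>.

  If \<open>y = t * x\<close>, use columns modulo \<open>x\<close> instead. Within a column, edges of length \<open>x\<close> and \<open>y\<close>
  behave like edges of length \<open>1\<close> and \<open>t\<close>, and neighbouring columns of the same height are traversed
  by the same path in the two directions.\<close>

subsection \<open>Paths starting at the vertex 0\<close>

abbreviation lengths :: "nat list \<Rightarrow> nat multiset" where
  "lengths \<equiv> path_linear_lengths"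

lemma lengths_Nil [simp]: "lengths [] = {#}"
  and lengths_single [simp]: "lengths [u] = {#}"
  and lengths_Cons2 [simp]: "lengths (u # w # p) = add_mset (linear_length u w) (lengths (w # p))"
  by (simp_all add: path_linear_lengths_def path_steps_def)

lemma linear_length_commute: "linear_length u w = linear_length w u"
  by (simp add: linear_length_def)

lemma linear_length_add [simp]:
  "linear_length u (u + k) = k" "linear_length (u + k) u = k"
  by (simp_all add: linear_length_def)

lemma linear_length_shift [simp]:
  "linear_length (u + k) (w + k) = linear_length u w"
  "linear_length (k + u) (k + w) = linear_length u w"
  "linear_length (Suc u) (Suc w) = linear_length u w"
  by (simp_all add: linear_length_def)

lemma size_lengths [simp]: "size (lengths p) = length p - 1"
  by (simp add: path_linear_lengths_def path_steps_def)

lemma lengths_append: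
  "p \<noteq> [] \<Longrightarrow> r \<noteq> [] \<Longrightarrow>
    lengths (p @ r) = lengths p + lengths r + {#linear_length (last p) (hd r)#}"
proof (induction p)
  case (Cons u p)
  then show ?case by (cases p; cases r) auto
qed simp

lemma lengths_rev [simp]: "lengths (rev p) = lengths p"
proof (induction p)
  case (Cons u p)
  then show ?case
    using lengths_append[of "rev p" "[u]"]
    by (cases p) (simp_all add: linear_length_commute)
qed simp

lemma lengths_map:
  assumes "\<And>u w. u \<in> set p \<Longrightarrow> w \<in> set p \<Longrightarrow> linear_length (f u) (f w) = g (linear_length u w)"
  shows "lengths (map f p) = image_mset g (lengths p)"
  using assms
proof (induction p)
  case (Cons u p)
  then show ?case by (cases p) auto
qed simp

lemma lengths_map_isometry:
  assumes "\<And>u w. u \<in> set p \<Longrightarrow> w \<in> set p \<Longrightarrow> linear_length (f u) (f w) = linear_length u w"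
  shows "lengths (map f p) = lengths p"
  using lengths_map[of p f "\<lambda>k. k"] assms by simp

lemma lengths_map_Suc [simp]: "lengths (map Suc p) = lengths p"
  by (rule lengths_map_isometry) simp

lemma lengths_map_add [simp]: "lengths (map ((+) k) p) = lengths p"
  by (rule lengths_map_isometry) simp

lemma lengths_map_diff: "\<forall>u\<in>set p. u \<le> k \<Longrightarrow> lengths (map ((-) k) p) = lengths p"
  by (rule lengths_map_isometry) (auto simp: linear_length_def)

text \<open>Distinctness is implied, since \<open>length p\<close> values fill as many entries. The
  start \<open>0\<close> is where two such paths are glued and where a new lowest vertex is
  attached.\<close>

definition std_path :: "nat list \<Rightarrow> bool" where
  "std_path p \<longleftrightarrow> p \<noteq> [] \<and> hd p = 0 \<and> set p = {..<length p}"

definition std_realizable :: "nat multiset \<Rightarrow> bool" where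
  "std_realizable M \<longleftrightarrow> (\<exists>p. std_path p \<and> lengths p = M)"

lemma distinct_if_set_eq: "set p = {..<length p} \<Longrightarrow> distinct p"
  by (rule card_distinct) simp

lemma std_path_distinct: "std_path p \<Longrightarrow> distinct p"
  by (auto simp: std_path_def intro: distinct_if_set_eq)

lemma zip_tl_neq: "distinct p \<Longrightarrow> (u, w) \<in> set (zip p (tl p)) \<Longrightarrow> u \<in> set p \<and> w \<in> set p \<and> u \<noteq> w"
proof (induction p)
  case (Cons v p)
  then show ?case by (cases p) auto
qed simp

lemma has_linear_realization_lengths:
  assumes "set p = {..<length p}" "p \<noteq> []"
  shows "has_linear_realization (lengths p)"
  unfolding has_linear_realization_def
proof (intro exI conjI)
  have "size (lengths p) + 1 = length p" using assms(2) by (cases p) auto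
  moreover have "{u, w} \<in> {{u, w} |u w. u < length p \<and> w < length p \<and> u \<noteq> w}"
    if "(u, w) \<in> set (path_steps p)" for u w
    using zip_tl_neq[OF distinct_if_set_eq[OF assms(1)], of u w] that assms(1)
    by (auto simp: path_steps_def)
  ultimately show "hamiltonian_path (complete_graph (size (lengths p) + 1)) p"
    using distinct_if_set_eq[OF assms(1)] assms(1)
    by (auto simp: hamiltonian_path_def complete_graph_def)
qed (rule refl)

lemma std_realizable_imp: "std_realizable M \<Longrightarrow> has_linear_realization M"
  unfolding std_realizable_def std_path_def using has_linear_realization_lengths by blast

text \<open>Two paths that start at \<open>0\<close> are joined there, after reflecting the first one.\<close>

lemma realization_join:
  assumes "std_realizable M" "std_realizable N"
  shows "has_linear_realization (M + N)"
proof -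
  obtain p where p: "std_path p" "lengths p = M" using assms(1) by (auto simp: std_realizable_def)
  obtain r where r: "std_path r" "lengths r = N" using assms(2) by (auto simp: std_realizable_def)
  \<comment> \<open>\<open>n\<close> is the largest vertex of \<open>p\<close>, so the reflection
    moves its start \<open>0\<close> to \<open>n\<close>, the start of the translate of
    \<open>r\<close>. The shared vertex is kept once by passing to \<open>r0\<close>.\<close>
  define n where "n = length p - 1"
  have n: "length p = Suc n" using p(1) by (cases p) (auto simp: n_def std_path_def)
  define p' where "p' = rev (map ((-) n) p)"
  define r' where "r' = map ((+) n) r"
  obtain r0 where r0: "r' = n # r0"
    using r(1) by (cases r) (auto simp: r'_def std_path_def)
  have setp': "set p' = {..n}"
  proof -
    have "set p' = (-) n ` {..n}" using p(1) n by (auto simp: p'_def std_path_def lessThan_Suc_atMost)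
    also have "\<dots> = {..n}"
    proof (intro equalityI subsetI)
      fix u assume "u \<in> {..n}"
      then have "u = n - (n - u)" "n - u \<in> {..n}" by auto
      then show "u \<in> (-) n ` {..n}" by blast
    qed auto
    finally show ?thesis .
  qed
  have last: "last p' = n" and p'ne: "p' \<noteq> []"
    using p(1) by (auto simp: p'_def std_path_def last_rev hd_map)
  have setr': "set r' = {n..<n + length r}"
  proof -
    have "set r' = (+) n ` {0..<length r}"
      using r(1) by (simp add: r'_def std_path_def lessThan_atLeast0)
    then show ?thesis by (simp add: add.commute)
  qed
  have distr': "distinct r'" using std_path_distinct[OF r(1)] by (simp add: r'_def distinct_map)
  have setr0: "set r0 = {n<..<n + length r}"
  proof -
    have "set r0 = set r' - {n}" using distr' by (simp add: r0)
    also have "\<dots> = {n<..<n + length r}" unfolding setr' by auto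
    finally show ?thesis .
  qed
  have len: "length (p' @ r0) = n + length r"
  proof -
    have "length r = Suc (length r0)" using arg_cong[OF r0, of length] by (simp add: r'_def)
    moreover have "length p' = Suc n" by (simp add: p'_def n)
    ultimately show ?thesis by simp
  qed
  obtain m where "length r = Suc m" using r(1) by (cases r) (auto simp: std_path_def)
  then have set: "set (p' @ r0) = {..<length (p' @ r0)}" unfolding len using setp' setr0 by auto
  have "lengths p' = M"
    using p lengths_map_diff[of p n] n by (auto simp: p'_def std_path_def)
  moreover have "lengths (n # r0) = N" using r r0 by (metis lengths_map_add r'_def)
  ultimately have "lengths (p' @ r0) = M + N"
    using last p'ne by (cases r0) (simp_all add: lengths_append)
  then show ?thesis using has_linear_realization_lengths[OF set] p'ne by simp
qed

lemma std_path_Cons_Suc: "std_path p \<Longrightarrow> std_path (0 # map Suc p)"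
  unfolding std_path_def by (auto simp: lessThan_Suc_eq_insert_0)

lemma lengths_Cons_Suc: "std_path p \<Longrightarrow> lengths (0 # map Suc p) = add_mset 1 (lengths p)"
  using lengths_map_Suc[of p] by (cases p) (auto simp: std_path_def linear_length_def)

text \<open>Every vertex is raised by one and a new \<open>0\<close> is put in front of the old
  start, which has become \<open>1\<close>.\<close>

lemma std_realizable_ones: "std_realizable M \<Longrightarrow> std_realizable (M + replicate_mset k 1)"
proof (induction k)
  case (Suc k)
  then obtain p where "std_path p" "lengths p = M + replicate_mset k 1"
    by (auto simp: std_realizable_def)
  then show ?case unfolding std_realizable_def
    by (intro exI[of _ "0 # map Suc p"]) (simp add: std_path_Cons_Suc lengths_Cons_Suc)
qed simp

lemma length_eq_size_lengths: "p \<noteq> [] \<Longrightarrow> length p = size (lengths p) + 1"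
  by (cases p) auto

subsection \<open>Zigzags and rotations\<close>

definition column :: "nat \<Rightarrow> nat \<Rightarrow> nat \<Rightarrow> nat list" where
  "column y h b = map (\<lambda>k. b + k * y) [0..<h]"

lemma column_Suc: "column y (Suc h) b = column y h b @ [b + h * y]"
  by (simp add: column_def)

lemma column_0 [simp]: "column y 0 b = []"
  by (simp add: column_def)

lemma length_column [simp]: "length (column y h b) = h"
  by (simp add: column_def)

lemma set_column: "set (column y h b) = {b + k * y |k. k < h}"
  by (auto simp: column_def)

lemma column_eq_Nil [simp]: "column y h b = [] \<longleftrightarrow> h = 0"
  by (simp add: column_def)

lemma hd_column [simp]: "0 < h \<Longrightarrow> hd (column y h b) = b"
  by (simp add: column_def hd_map)

lemma last_column [simp]: "0 < h \<Longrightarrow> last (column y h b) = b + (h - 1) * y"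
  by (cases h) (simp_all add: column_Suc)

lemma lengths_column [simp]: "lengths (column y h b) = replicate_mset (h - 1) y"
proof (induction h)
  case (Suc h)
  show ?case
  proof (cases h)
    case (Suc k)
    then show ?thesis
      using Suc.IH by (subst column_Suc) (simp add: lengths_append linear_length_def)
  qed (simp add: column_def)
qed simp

fun zigzag :: "bool \<Rightarrow> nat \<Rightarrow> nat \<Rightarrow> nat list \<Rightarrow> nat list" where
  "zigzag up y h [] = []"
| "zigzag up y h (b # B) =
    (if up then column y h b else rev (column y h b)) @ zigzag (\<not> up) y h B"

lemma zigzag_eq_Nil [simp]: "0 < h \<Longrightarrow> zigzag up y h B = [] \<longleftrightarrow> B = []"
  by (cases B) auto

lemma length_zigzag [simp]: "length (zigzag up y h B) = h * length B"
  by (induction up y h B rule: zigzag.induct) auto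

lemma set_zigzag: "set (zigzag up y h B) = (\<Union>b\<in>set B. set (column y h b))"
  by (induction up y h B rule: zigzag.induct) auto

lemma zigzag_1 [simp]: "zigzag up y (Suc 0) B = B"
  by (induction up y "Suc 0" B rule: zigzag.induct) (auto simp: column_def)

lemma hd_zigzag: "0 < h \<Longrightarrow> B \<noteq> [] \<Longrightarrow>
    hd (zigzag up y h B) = hd B + (if up then 0 else (h - 1) * y)"
  by (cases B) (auto simp: hd_rev)

lemma last_zigzag: "0 < h \<Longrightarrow> B \<noteq> [] \<Longrightarrow>
    last (zigzag up y h B) = last B + (if up = odd (length B) then (h - 1) * y else 0)"
proof (induction up y h B rule: zigzag.induct)
  case (2 up y h b B)
  then show ?case by (cases "B = []") (auto simp: last_rev)
qed simp

lemma replicate_mset_add: "replicate_mset (m + n) u = replicate_mset m u + replicate_mset n u"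
  by (induction m) auto

text \<open>Consecutive columns run in opposite directions, so each is entered at the height where
  the previous one was left, and the connecting edge is as long as the difference of the bottoms.
  The number of vertical edges is fixed later by counting vertices.\<close>

lemma lengths_zigzag:
  assumes "0 < h"
  shows "\<exists>m. lengths (zigzag up y h B) = lengths B + replicate_mset m y"
proof (induction B arbitrary: up)
  case (Cons b B)
  obtain m where m: "lengths (zigzag (\<not> up) y h B) = lengths B + replicate_mset m y"
    using Cons by blast
  let ?c = "if up then column y h b else rev (column y h b)"
  show ?case
  proof (cases "B = []")
    case True
    then show ?thesis by auto
  next
    case False
    then obtain b' B' where B: "B = b' # B'" by (cases B) auto
    have "linear_length (last ?c) (hd (zigzag (\<not> up) y h B)) = linear_length b b'"
      using assms by (auto simp: B last_rev hd_rev)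
    moreover have "?c \<noteq> []" "zigzag (\<not> up) y h B \<noteq> []" using assms False by auto
    ultimately have "lengths (zigzag up y h (b # B)) =
        lengths (b # B) + replicate_mset (h - 1 + m) y"
      using lengths_append[of ?c "zigzag (\<not> up) y h B"] m
      by (simp add: B replicate_mset_add del: zigzag.simps) (simp add: B)
    then show ?thesis by blast
  qed
qed auto

section \<open>Consecutive entries of a path, and rotations\<close>

definition adjacent_in :: "'a list \<Rightarrow> 'a \<Rightarrow> 'a \<Rightarrow> bool" where
  "adjacent_in p u w \<longleftrightarrow> (\<exists>p1 p2. p = p1 @ u # w # p2)"

lemma adjacent_in_append1: "adjacent_in p u w \<Longrightarrow> adjacent_in (p @ r) u w"
  unfolding adjacent_in_def by fastforce

lemma adjacent_in_append2: "adjacent_in p u w \<Longrightarrow> adjacent_in (r @ p) u w"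
  unfolding adjacent_in_def by (metis append.assoc)

lemma adjacent_in_Cons: "adjacent_in p u w \<Longrightarrow> adjacent_in (v # p) u w"
  using adjacent_in_append2[of p u w "[v]"] by simp

lemma adjacent_in_rev: "adjacent_in p u w \<Longrightarrow> adjacent_in (rev p) w u"
  unfolding adjacent_in_def by (metis append.assoc append_Cons append_Nil rev.simps(2) rev_append)

lemma adjacent_in_column:
  assumes "Suc k < h"
  shows "adjacent_in (column y h b) (b + k * y) (b + Suc k * y)"
proof -
  have "[0..<h] = [0..<k] @ k # Suc k # [Suc (Suc k)..<h]"
    using assms upt_add_eq_append[of 0 k "h - k"] by (simp add: upt_conv_Cons)
  then show ?thesis unfolding adjacent_in_def column_def by fastforce
qed

lemma adjacent_in_zigzag_up:
  assumes "i < length B" "up = even i" "Suc k < h"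
  shows "adjacent_in (zigzag up y h B) (B ! i + k * y) (B ! i + Suc k * y)"
  using assms
proof (induction B arbitrary: i up)
  case (Cons b B)
  show ?case
  proof (cases i)
    case 0
    then show ?thesis using Cons.prems adjacent_in_column[of k h y b] adjacent_in_append1 by simp
  next
    case (Suc j)
    then have "adjacent_in (zigzag (\<not> up) y h B) (B ! j + k * y) (B ! j + Suc k * y)"
      using Cons.IH[of j "\<not> up"] Cons.prems by simp
    then show ?thesis using Suc by (auto intro: adjacent_in_append2)
  qed
qed simp

lemma adjacent_in_zigzag_down:
  assumes "i < length B" "up = odd i" "Suc k < h"
  shows "adjacent_in (zigzag up y h B) (B ! i + Suc k * y) (B ! i + k * y)"
  using assms
proof (induction B arbitrary: i up)
  case (Cons b B)
  show ?case
  proof (cases i)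
    case 0
    then show ?thesis
      using Cons.prems adjacent_in_rev[OF adjacent_in_column[of k h y b]] adjacent_in_append1 by simp
  next
    case (Suc j)
    then have "adjacent_in (zigzag (\<not> up) y h B) (B ! j + Suc k * y) (B ! j + k * y)"
      using Cons.IH[of j "\<not> up"] Cons.prems by simp
    then show ?thesis using Suc by (auto intro: adjacent_in_append2)
  qed
qed simp

text \<open>A Posa rotation: the part of the path after \<open>u\<close> is reversed.\<close>

lemma std_realizable_rotate:
  assumes p: "std_path p" and adj: "adjacent_in p u w"
    and len: "lengths p = add_mset (linear_length u w) M"
  shows "std_realizable (add_mset (linear_length u (last p)) M)"
proof -
  obtain p1 p2 where p_eq: "p = p1 @ u # w # p2" using adj by (auto simp: adjacent_in_def)
  let ?r = "p1 @ u # rev (w # p2)"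
  have "std_path ?r"
    using p unfolding std_path_def p_eq by (cases p1) auto
  moreover have "lengths ?r = add_mset (linear_length u (last p)) M"
  proof -
    have "lengths p = lengths (p1 @ [u]) + lengths (w # p2) + {#linear_length u w#}"
      using lengths_append[of "p1 @ [u]" "w # p2"] by (simp add: p_eq)
    then have "M = lengths (p1 @ [u]) + lengths (w # p2)" using len by simp
    moreover have "lengths ?r = lengths (p1 @ [u]) + lengths (rev (w # p2)) +
        {#linear_length u (last (w # p2))#}"
      using lengths_append[of "p1 @ [u]" "rev (w # p2)"] by (simp add: hd_rev del: lengths_rev)
    ultimately show ?thesis unfolding lengths_rev by (simp add: p_eq)
  qed
  ultimately show ?thesis unfolding std_realizable_def by blast
qed

subsection \<open>Zigzags through residue classes\<close>

definition zigzag2 :: "nat \<Rightarrow> nat \<Rightarrow> nat list \<Rightarrow> nat \<Rightarrow> nat list \<Rightarrow> nat list" where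
  "zigzag2 y h1 B1 h2 B2 = zigzag True y h1 B1 @ zigzag True y h2 B2"

text \<open>The first block has to be left at the bottom, where the second is entered. An even
  number of columns achieves this; for height 1 top and bottom coincide, and for empty
  \<open>B2\<close> there is no passage.\<close>

lemma lengths_zigzag2:
  assumes "0 < h1" "0 < h2" "even (length B1) \<or> h1 = 1 \<or> B2 = []"
  shows "\<exists>m. lengths (zigzag2 y h1 B1 h2 B2) = lengths (B1 @ B2) + replicate_mset m y"
proof -
  obtain m1 m2 where m: "lengths (zigzag True y h1 B1) = lengths B1 + replicate_mset m1 y"
      "lengths (zigzag True y h2 B2) = lengths B2 + replicate_mset m2 y"
    using lengths_zigzag assms by metis
  show ?thesis
  proof (cases "B1 = [] \<or> B2 = []")
    case True
    then show ?thesis using m by (auto simp: zigzag2_def)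
  next
    case False
    then have "last (zigzag True y h1 B1) = last B1" "hd (zigzag True y h2 B2) = hd B2"
      using assms by (auto simp: last_zigzag hd_zigzag)
    then have "lengths (zigzag2 y h1 B1 h2 B2) = lengths (B1 @ B2) + replicate_mset (m1 + m2) y"
      using False assms(1,2) by (simp add: zigzag2_def lengths_append m replicate_mset_add)
    then show ?thesis by blast
  qed
qed

lemma hd_zigzag2:
  "0 < h1 \<Longrightarrow> 0 < h2 \<Longrightarrow> B1 @ B2 \<noteq> [] \<Longrightarrow> hd (zigzag2 y h1 B1 h2 B2) = hd (B1 @ B2)"
  by (cases "B1 = []") (auto simp: zigzag2_def hd_zigzag)

lemma last_zigzag2: "0 < h2 \<Longrightarrow> B2 \<noteq> [] \<Longrightarrow>
    last (zigzag2 y h1 B1 h2 B2) = last B2 + (if odd (length B2) then (h2 - 1) * y else 0)"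
  by (auto simp: zigzag2_def last_zigzag)

lemma length_zigzag2 [simp]: "length (zigzag2 y h1 B1 h2 B2) = h1 * length B1 + h2 * length B2"
  by (simp add: zigzag2_def)

text \<open>As \<open>B1\<close> has even length, the parity of the index in \<open>B1 @ B2\<close>
  decides the direction of a column in both blocks; even indices go up.\<close>

lemma adjacent_in_zigzag2_up:
  assumes "even (length B1)" "i < length (B1 @ B2)" "even i" "Suc k < h1" "Suc k < h2"
  shows "adjacent_in (zigzag2 y h1 B1 h2 B2) ((B1 @ B2) ! i + k * y) ((B1 @ B2) ! i + Suc k * y)"
proof (cases "i < length B1")
  case True
  then show ?thesis unfolding zigzag2_def nth_append
    using adjacent_in_append1[OF adjacent_in_zigzag_up[of i B1 True k h1 y]] assms by simp
next
  case False
  have "i - length B1 < length B2" "even (i - length B1)" using False assms by auto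
  then show ?thesis unfolding zigzag2_def nth_append
    using False adjacent_in_append2[OF adjacent_in_zigzag_up[of "i - length B1" B2 True k h2 y]]
      assms by simp
qed

lemma adjacent_in_zigzag2_down:
  assumes "even (length B1)" "i < length (B1 @ B2)" "odd i" "Suc k < h1" "Suc k < h2"
  shows "adjacent_in (zigzag2 y h1 B1 h2 B2) ((B1 @ B2) ! i + Suc k * y) ((B1 @ B2) ! i + k * y)"
proof (cases "i < length B1")
  case True
  then show ?thesis unfolding zigzag2_def nth_append
    using adjacent_in_append1[OF adjacent_in_zigzag_down[of i B1 True k h1 y]] assms by simp
next
  case False
  have "i - length B1 < length B2" "odd (i - length B1)" using False assms by auto
  then show ?thesis unfolding zigzag2_def nth_append
    using False adjacent_in_append2[OF adjacent_in_zigzag_down[of "i - length B1" B2 True k h2 y]]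
      assms by simp
qed

text \<open>Division by \<open>y\<close> yields \<open>b\<close> and \<open>k\<close>; the
  incomplete last row of length \<open>T\<close> gives one more element to the residues below
  \<open>T\<close>.\<close>

lemma grid_eq_lessThan:
  fixes q T y :: nat
  assumes "T \<le> y" "0 < y"
  shows "{b + k * y |b k. b < T \<and> k < Suc q} \<union> {b + k * y |b k. T \<le> b \<and> b < y \<and> k < q}
    = {..<q * y + T}" (is "?L \<union> ?R = _")
proof (intro equalityI subsetI)
  fix n assume "n \<in> ?L \<union> ?R"
  then consider b k where "n = b + k * y" "b < T" "k \<le> q" | b k where "n = b + k * y" "b < y" "Suc k \<le> q"
    by (auto simp: less_Suc_eq_le Suc_le_eq)
  then show "n \<in> {..<q * y + T}"
  proof cases
    case 1
    have "k * y \<le> q * y" using 1(3) by (rule mult_le_mono1)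
    then have "n < q * y + T" using 1 by linarith
    then show ?thesis by simp
  next
    case 2
    have "Suc k * y \<le> q * y" using 2(3) by (rule mult_le_mono1)
    then have "n < q * y + T" using 2 by simp
    then show ?thesis by simp
  qed
next
  fix n assume n: "n \<in> {..<q * y + T}"
  define b k where "b = n mod y" and "k = n div y"
  have nbk: "n = b + k * y" "b < y" using assms by (auto simp: b_def k_def)
  have "k < Suc q"
  proof (rule ccontr)
    assume "\<not> k < Suc q"
    then have "Suc q * y \<le> k * y" by (intro mult_le_mono1) simp
    then show False using n nbk assms by simp
  qed
  moreover have "k < q" if "T \<le> b"
  proof (rule ccontr)
    assume "\<not> k < q"
    then have "q * y \<le> k * y" by (intro mult_le_mono1) simp
    then show False using n nbk that unfolding lessThan_iff by linarith
  qed
  ultimately show "n \<in> ?L \<union> ?R" using nbk by (cases "b < T") auto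
qed

text \<open>The entries are residues modulo \<open>y\<close>. The residues below \<open>T\<close>, visited first, will be those whose
  class among the first \<open>q * y + T\<close> vertices has \<open>q + 1\<close> elements instead of \<open>q\<close>.\<close>

definition split_path :: "nat \<Rightarrow> nat \<Rightarrow> nat list \<Rightarrow> bool" where
  "split_path y T s \<longleftrightarrow> std_path s \<and> length s = y \<and> set (take T s) = {..<T}"

lemma split_path_upt: "0 < y \<Longrightarrow> T \<le> y \<Longrightarrow> split_path y T [0..<y]"
  by (auto simp: split_path_def std_path_def take_upt hd_upt)

lemma split_path_whole:
  assumes "std_path s" "T = 0 \<or> T = length s"
  shows "split_path (length s) T s"
proof -
  have "set s = {..<length s}" using assms by (simp add: std_path_def)
  then have "set (take T s) = {..<T}" using assms(2) by (elim disjE) simp_all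
  then show ?thesis using assms(1) by (simp add: split_path_def)
qed

lemma lengths_upt: "lengths [0..<y] = replicate_mset (y - 1) 1"
  using lengths_column[of 1 y 0] by (simp add: column_def)

lemma set_drop_split_path:
  assumes "split_path y T s"
  shows "set (drop T s) = {T..<y}"
proof -
  have "distinct s" "set s = {..<y}" "set (take T s) = {..<T}"
    using assms std_path_distinct by (auto simp: split_path_def std_path_def)
  moreover have "set (take T s) \<inter> set (drop T s) = {}"
    using \<open>distinct s\<close> set_take_disj_set_drop_if_distinct by blast
  moreover have "set (take T s) \<union> set (drop T s) = set s"
    by (metis append_take_drop_id set_append)
  ultimately have "set (drop T s) = {..<y} - {..<T}" by blast
  then show ?thesis by auto
qed

lemma replicate_mset_lengths:
  assumes "lengths p = N + replicate_mset m y" "length p = size N + c + 1"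
  shows "lengths p = N + replicate_mset c y"
  using assms size_lengths[of p] by simp

definition zigzag_tall_first :: "nat \<Rightarrow> nat \<Rightarrow> nat \<Rightarrow> nat list \<Rightarrow> nat list" where
  "zigzag_tall_first y q T s = zigzag2 y (Suc q) (take T s) q (drop T s)"

text \<open>The condition on \<open>c\<close> says that the grid has \<open>c + y\<close> vertices,
  one more than the \<open>y - 1\<close> steps of \<open>s\<close> and the \<open>c\<close> vertical
  edges together. Even \<open>T\<close> lets the tall block end at the bottom.\<close>

lemma zigzag_tall_first:
  assumes s: "split_path y T s" and "T < y" "even T" "0 < q" and c: "q * y + T = c + y"
  shows "std_path (zigzag_tall_first y q T s)"
    "lengths (zigzag_tall_first y q T s) = lengths s + replicate_mset c y"
proof -
  let ?p = "zigzag_tall_first y q T s"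
  have len: "length ?p = c + y"
  proof -
    obtain d where "y = T + d" using \<open>T < y\<close> less_imp_add_positive by blast
    then show ?thesis
      using s c by (simp add: zigzag_tall_first_def split_path_def algebra_simps)
  qed
  have "set ?p = {b + k * y |b k. b < T \<and> k < Suc q} \<union> {b + k * y |b k. T \<le> b \<and> b < y \<and> k < q}"
    using set_drop_split_path[OF s] s
    by (auto simp: zigzag_tall_first_def zigzag2_def set_zigzag set_column split_path_def)
  then have set: "set ?p = {..<length ?p}"
    using grid_eq_lessThan[of T y q] \<open>T < y\<close> len c by simp
  have "s \<noteq> []" "hd s = 0" "length s = y" using s by (auto simp: split_path_def std_path_def)
  have "hd ?p = 0"
    using hd_zigzag2[of "Suc q" q "take T s" "drop T s" y] \<open>0 < q\<close> \<open>s \<noteq> []\<close> \<open>hd s = 0\<close>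
    by (simp add: zigzag_tall_first_def)
  moreover have "?p \<noteq> []" using len \<open>T < y\<close> by force
  ultimately show "std_path ?p" using set by (simp add: std_path_def)
  have "even (length (take T s))" using \<open>even T\<close> \<open>T < y\<close> s by (simp add: split_path_def min_def)
  then obtain m where "lengths ?p = lengths s + replicate_mset m y"
    using lengths_zigzag2[of "Suc q" q "take T s" "drop T s" y] \<open>0 < q\<close>
    by (auto simp: zigzag_tall_first_def)
  then show "lengths ?p = lengths s + replicate_mset c y"
    by (rule replicate_mset_lengths) (use len \<open>T < y\<close> \<open>length s = y\<close> in simp)
qed

text \<open>After the vertex \<open>0\<close>, the columns start at \<open>1, \<dots>, y\<close> and are traversed in the reverse order.
  The column starting at \<open>y\<close> is the residue class of \<open>0\<close>, deprived of \<open>0\<close>.\<close>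

definition zigzag_short_first :: "nat \<Rightarrow> nat \<Rightarrow> nat \<Rightarrow> nat list \<Rightarrow> nat list" where
  "zigzag_short_first y q T s =
    0 # zigzag2 y q (map ((-) y) (take T s)) (Suc q) (map ((-) y) (drop T s))"

text \<open>The map \<open>(-) y\<close> sends the start \<open>0\<close> of \<open>s\<close> to the
  column at \<open>y\<close>, which the vertex \<open>0\<close> reaches by an edge of length
  \<open>y\<close>, and the residues below \<open>T\<close> to the \<open>T\<close> largest bottoms,
  whose columns are the short ones. The last hypothesis lists the situations in which the blocks fit
  together.\<close>

lemma zigzag_short_first:
  assumes s: "split_path y T s" and "0 < T" "T \<le> y" "0 < q" and c: "T + c = q * y + 1"
    and T: "even T \<or> T = y \<or> q = 1"
  shows "std_path (zigzag_short_first y q T s)"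
    "lengths (zigzag_short_first y q T s) = lengths s + replicate_mset c y"
proof -
  let ?p = "zigzag_short_first y q T s"
  have "s \<noteq> []" "hd s = 0" "length s = y" and sets: "set s = {..<y}"
    using s by (auto simp: split_path_def std_path_def)
  have len: "length ?p = c + y"
  proof -
    obtain d where "y = T + d" using \<open>T \<le> y\<close> le_Suc_ex by blast
    then show ?thesis
      using \<open>length s = y\<close> c by (simp add: zigzag_short_first_def algebra_simps)
  qed
  have take: "set (map ((-) y) (take T s)) = {b. y - T < b \<and> b \<le> y}" (is "?M = _")
  proof -
    have "?M = (-) y ` {..<T}" using s by (simp add: split_path_def)
    also have "\<dots> = {b. y - T < b \<and> b \<le> y}"
    proof (intro equalityI subsetI)
      fix b assume "b \<in> {b. y - T < b \<and> b \<le> y}"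
      then have "b = y - (y - b)" "y - b \<in> {..<T}" using \<open>T \<le> y\<close> by auto
      then show "b \<in> (-) y ` {..<T}" by blast
    qed (use \<open>T \<le> y\<close> in auto)
    finally show ?thesis .
  qed
  have drop: "set (map ((-) y) (drop T s)) = {b. 0 < b \<and> b \<le> y - T}" (is "?M = _")
  proof -
    have "?M = (-) y ` {T..<y}" using set_drop_split_path[OF s] by simp
    also have "\<dots> = {b. 0 < b \<and> b \<le> y - T}"
    proof (intro equalityI subsetI)
      fix b assume "b \<in> {b. 0 < b \<and> b \<le> y - T}"
      then have "b = y - (y - b)" "y - b \<in> {T..<y}" using \<open>T \<le> y\<close> by auto
      then show "b \<in> (-) y ` {T..<y}" by blast
    qed auto
    finally show ?thesis .
  qed
  \<comment> \<open>Lowering every vertex except \<open>0\<close> by one gives a grid in which the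
    first \<open>y - T\<close> columns are the tall ones.\<close>
  have "set ?p = insert 0 (Suc ` ({b + k * y |b k. b < y - T \<and> k < Suc q} \<union>
      {b + k * y |b k. y - T \<le> b \<and> b < y \<and> k < q}))" (is "_ = insert 0 (Suc ` ?G)")
  proof -
    have "set ?p = insert 0 ({b + k * y |b k. y - T < b \<and> b \<le> y \<and> k < q} \<union>
        {b + k * y |b k. 0 < b \<and> b \<le> y - T \<and> k < Suc q})"
      using take drop
      by (auto simp: zigzag_short_first_def zigzag2_def set_zigzag set_column simp del: set_map)
    also have "{b + k * y |b k. y - T < b \<and> b \<le> y \<and> k < q} =
        Suc ` {b + k * y |b k. y - T \<le> b \<and> b < y \<and> k < q}"
    proof (intro equalityI subsetI)
      fix n assume "n \<in> {b + k * y |b k. y - T < b \<and> b \<le> y \<and> k < q}"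
      then obtain b k where "n = b + k * y" "y - T < b" "b \<le> y" "k < q" by blast
      then have "n = Suc (b - 1 + k * y)" "y - T \<le> b - 1" "b - 1 < y" "k < q" by auto
      then show "n \<in> Suc ` {b + k * y |b k. y - T \<le> b \<and> b < y \<and> k < q}" by blast
    next
      fix n assume "n \<in> Suc ` {b + k * y |b k. y - T \<le> b \<and> b < y \<and> k < q}"
      then obtain b k where "n = Suc b + k * y" "y - T < Suc b" "Suc b \<le> y" "k < q" by force
      then show "n \<in> {b + k * y |b k. y - T < b \<and> b \<le> y \<and> k < q}" by blast
    qed
    also have "{b + k * y |b k. 0 < b \<and> b \<le> y - T \<and> k < Suc q} =
        Suc ` {b + k * y |b k. b < y - T \<and> k < Suc q}"
    proof (intro equalityI subsetI)
      fix n assume "n \<in> {b + k * y |b k. 0 < b \<and> b \<le> y - T \<and> k < Suc q}"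
      then obtain b k where "n = b + k * y" "0 < b" "b \<le> y - T" "k < Suc q" by blast
      then have "n = Suc (b - 1 + k * y)" "b - 1 < y - T" "k < Suc q" by auto
      then show "n \<in> Suc ` {b + k * y |b k. b < y - T \<and> k < Suc q}" by blast
    next
      fix n assume "n \<in> Suc ` {b + k * y |b k. b < y - T \<and> k < Suc q}"
      then obtain b k where "n = Suc b + k * y" "0 < Suc b" "Suc b \<le> y - T" "k < Suc q" by force
      then show "n \<in> {b + k * y |b k. 0 < b \<and> b \<le> y - T \<and> k < Suc q}" by blast
    qed
    finally show ?thesis by (simp add: image_Un Un_commute)
  qed
  also have "?G = {..<q * y + (y - T)}" using grid_eq_lessThan[of "y - T" y q] \<open>0 < T\<close> \<open>T \<le> y\<close> by simp
  also have "insert 0 (Suc ` {..<q * y + (y - T)}) = {..<length ?p}"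
    using len c \<open>T \<le> y\<close> by (simp flip: lessThan_Suc_eq_insert_0)
  finally have set: "set ?p = {..<length ?p}" .
  then show "std_path ?p" by (simp add: std_path_def zigzag_short_first_def)
  have "even (length (take T s)) \<or> q = 1 \<or> drop T s = []"
    using T \<open>T \<le> y\<close> \<open>length s = y\<close> by (auto simp: min_def)
  then obtain m where m: "lengths (tl ?p) = lengths (map ((-) y) s) + replicate_mset m y"
    using lengths_zigzag2[of q "Suc q" "map ((-) y) (take T s)" "map ((-) y) (drop T s)" y] \<open>0 < q\<close>
    by (auto simp: zigzag_short_first_def simp flip: map_append)
  have "hd (tl ?p) = y"
  proof -
    have "hd (tl ?p) = hd (map ((-) y) s)"
      using hd_zigzag2[of q "Suc q" "map ((-) y) (take T s)" "map ((-) y) (drop T s)" y]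
        \<open>0 < q\<close> \<open>s \<noteq> []\<close> by (auto simp: zigzag_short_first_def simp flip: map_append)
    then show ?thesis using \<open>s \<noteq> []\<close> \<open>hd s = 0\<close> by (simp add: hd_map)
  qed
  moreover have "0 < q * y" using \<open>0 < T\<close> \<open>T \<le> y\<close> \<open>0 < q\<close> by simp
  then have "1 < c + y" using \<open>T \<le> y\<close> c by linarith
  then have "length (tl ?p) > 0" using len by simp
  then have "tl ?p \<noteq> []" unfolding length_greater_0_conv .
  moreover have "lengths (map ((-) y) s) = lengths s"
    by (rule lengths_map_diff) (auto simp: sets)
  \<comment> \<open>The extra edge of length \<open>y\<close> joins \<open>0\<close> to
    \<open>y\<close>.\<close>
  ultimately have "lengths ?p = lengths s + replicate_mset (Suc m) y"
    using lengths_append[of "[0]" "tl ?p"] m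
    by (simp add: zigzag_short_first_def linear_length_def)
  then show "lengths ?p = lengths s + replicate_mset c y"
    by (rule replicate_mset_lengths) (use len \<open>0 < T\<close> \<open>T \<le> y\<close> \<open>length s = y\<close> in simp)
qed

lemma std_realizable_tall_first:
  assumes "split_path y (c mod y) s" "even (c mod y)" "0 < y"
  shows "std_realizable (lengths s + replicate_mset c y)"
proof -
  have "Suc (c div y) * y + c mod y = c + y" by simp
  then show ?thesis
    using zigzag_tall_first[of y "c mod y" s "Suc (c div y)" c] assms
    unfolding std_realizable_def by auto
qed

lemma std_realizable_short_first:
  assumes "split_path y T s" "0 < T" "T \<le> y" "0 < q" "T + c = q * y + 1"
    "even T \<or> T = y \<or> q = 1"
  shows "std_realizable (lengths s + replicate_mset c y)"
  using zigzag_short_first[OF assms] unfolding std_realizable_def by auto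

section \<open>Trading an edge of length \<open>y\<close> for another one by a rotation\<close>

lemma even_nth_iff:
  "\<forall>l\<in>#lengths p. odd l \<Longrightarrow> i < length p \<Longrightarrow> even (p ! i) \<longleftrightarrow> even (hd p + i)"
proof (induction p arbitrary: i)
  case (Cons u p)
  show ?case
  proof (cases i)
    case (Suc j)
    then obtain w p' where p: "p = w # p'" using Cons.prems by (cases p) auto
    have "odd (linear_length u w)" using Cons.prems by (simp add: p)
    then have "even w \<longleftrightarrow> odd u"
      by (auto simp: linear_length_def even_nat_iff abs_if split: if_splits)
    then show ?thesis using Cons.IH[of j] Cons.prems Suc p by auto
  qed simp
qed simp

text \<open>A path with \<open>c + 1\<close> edges of length \<open>y\<close> is rotated so that one
  of them gives way to an edge of length \<open>k\<close>. All steps of \<open>s\<close> and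
  \<open>k\<close> itself are odd, so a column \<open>b\<close> at distance \<open>k\<close> from
  the last one runs in the opposite direction. At the final height the path therefore continues in
  column \<open>b\<close> along a vertical edge, which the rotation cuts.\<close>

lemma std_realizable_rotated:
  assumes s: "split_path y T s" and T: "T = Suc c mod y" "even T" and "y \<le> c" "0 < y"
    and odd: "\<forall>l\<in>#lengths s. odd l" "odd k" and k: "k \<le> last s \<or> last s + k < y"
  shows "std_realizable (add_mset k (lengths s + replicate_mset c y))"
proof -
  \<comment> \<open>By \<open>y \<le> c\<close> the short columns have height \<open>r + 2\<close>,
    so each of them contains a vertical edge.\<close>
  define r where "r = Suc c div y - 1"
  have "Suc c div y \<ge> 1" using \<open>y \<le> c\<close> \<open>0 < y\<close> div_le_mono[of y "Suc c" y] by simp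
  then have "Suc c div y = Suc r" by (simp add: r_def)
  then have c: "Suc (Suc r) * y + T = Suc c + y" using T div_mult_mod_eq[of "Suc c" y] by simp
  let ?p = "zigzag_tall_first y (Suc (Suc r)) T s"
  have "T < y" using T \<open>0 < y\<close> by simp
  note p = zigzag_tall_first[OF s \<open>T < y\<close> \<open>even T\<close> _ c]
  have len: "length s = y" and sets: "set s = {..<y}" and "hd s = 0"
    using s by (auto simp: split_path_def std_path_def)
  have even: "even (s ! i) \<longleftrightarrow> even i" if "i < y" for i
    using even_nth_iff[of s i] odd(1) that len \<open>hd s = 0\<close> by simp
  have "last s = s ! (y - 1)" using len \<open>0 < y\<close> by (subst last_conv_nth) auto
  then have evenw: "even (last s) \<longleftrightarrow> odd y" using even[of "y - 1"] \<open>0 < y\<close> by simp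
  obtain b where b: "b < y" "linear_length b (last s) = k"
  proof (cases "k \<le> last s")
    case True
    have "last s < y" using sets len \<open>0 < y\<close> last_in_set[of s] by auto
    then show ?thesis using that[of "last s - k"] True by (simp add: linear_length_def)
  next
    case False
    then show ?thesis using that[of "last s + k"] k by simp
  qed
  obtain i where i: "i < y" "b = s ! i"
    using b(1) sets len by (metis in_set_conv_nth lessThan_iff)
  have evenb: "even b \<longleftrightarrow> even y"
  proof -
    have "odd (linear_length b (last s))" using b odd by simp
    then have "even b \<longleftrightarrow> odd (last s)"
      by (auto simp: linear_length_def even_nat_iff abs_if split: if_splits)
    then show ?thesis using evenw by simp
  qed
  have lastp: "last ?p = last s + (if odd y then Suc r * y else 0)"
    using last_zigzag2[of "Suc (Suc r)" "drop T s" y "Suc (Suc (Suc r))" "take T s"] \<open>T < y\<close> len \<open>even T\<close>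
    by (auto simp: zigzag_tall_first_def)
  have evenT: "even (length (take T s))" using \<open>even T\<close> \<open>T < y\<close> len by simp
  \<comment> \<open>For even \<open>y\<close> the path ends at the bottom and column
    \<open>b\<close> is climbed; for odd \<open>y\<close> it ends in row \<open>r + 1\<close> and
    column \<open>b\<close> is descended.\<close>
  show ?thesis
  proof (cases "even y")
    case True
    then have "adjacent_in ?p b (b + y)"
      using adjacent_in_zigzag2_up[OF evenT, of i "drop T s" 0 "Suc (Suc (Suc r))" "Suc (Suc r)" y]
        i len even[of i] evenb by (simp add: zigzag_tall_first_def)
    then show ?thesis
      using std_realizable_rotate[of ?p b "b + y" "lengths s + replicate_mset c y"] p b lastp True
      by simp
  next
    case False
    then have "adjacent_in ?p (b + Suc r * y) (b + r * y)"
      using adjacent_in_zigzag2_down[OF evenT, of i "drop T s" r "Suc (Suc (Suc r))" "Suc (Suc r)" y]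
        i len even[of i] evenb by (simp add: zigzag_tall_first_def)
    moreover have "linear_length (b + Suc r * y) (b + r * y) = y" by (simp add: linear_length_def)
    moreover have "linear_length (b + Suc r * y) (last ?p) = k"
      using lastp False b(2) linear_length_shift(1)[of b "Suc r * y" "last s"] by simp
    ultimately show ?thesis
      using std_realizable_rotate[of ?p "b + Suc r * y" "b + r * y" "lengths s + replicate_mset c y"] p
      by simp
  qed
qed

text \<open>In the plain order, columns at an even distance run in the same direction, so the
  partner of the last vertex is sought across a row boundary. Odd \<open>y\<close> makes the path
  end at the top of the tall column \<open>1\<close>, in row \<open>r + 2\<close>. The vertex lower
  by \<open>k\<close> lies in row \<open>r + 1\<close> of column \<open>y + 1 - k\<close>, which has
  the odd index \<open>k - 1\<close> and is descended.\<close>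

lemma std_realizable_rotated_even:
  assumes "odd y" "even T" "0 < T" "T < y" and c: "T + c = Suc (Suc r) * y" and k: "even k" "0 < k" "k < y"
  shows "std_realizable (add_mset k (replicate_mset (y - 1) 1 + replicate_mset c y))"
proof -
  let ?s = "[0..<y]"
  let ?p = "zigzag_short_first y (Suc (Suc r)) T ?s"
  have s: "split_path y T ?s" using assms by (intro split_path_upt) auto
  have c': "T + Suc c = Suc (Suc r) * y + 1" using c by simp
  have "T \<le> y" "0 < Suc (Suc r)" "even T \<or> T = y \<or> Suc (Suc r) = 1" using assms by auto
  note p = zigzag_short_first[OF s \<open>0 < T\<close> \<open>T \<le> y\<close> this(2) c' this(3)]
  let ?B1 = "map ((-) y) (take T ?s)" and ?B2 = "map ((-) y) (drop T ?s)"
  have B: "?B1 @ ?B2 = map ((-) y) ?s"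
    by (simp only: append_take_drop_id flip: map_append)
  have "length (zigzag2 y (Suc (Suc r)) ?B1 (Suc (Suc (Suc r))) ?B2) \<noteq> 0"
    using assms by simp
  then have "zigzag2 y (Suc (Suc r)) ?B1 (Suc (Suc (Suc r))) ?B2 \<noteq> []" by fastforce
  then have "last ?p = 1 + Suc (Suc r) * y"
    using last_zigzag2[of "Suc (Suc (Suc r))" ?B2 y "Suc (Suc r)" ?B1] assms
    by (simp add: zigzag_short_first_def last_map)
  moreover have "adjacent_in ?p (y + 1 - k + Suc r * y) (y + 1 - k + r * y)"
  proof -
    have "k - 1 < length (?B1 @ ?B2)" "odd (k - 1)" "even (length ?B1)"
      using k assms by (auto simp: B simp del: drop_upt)
    then have "adjacent_in (zigzag2 y (Suc (Suc r)) ?B1 (Suc (Suc (Suc r))) ?B2)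
        ((?B1 @ ?B2) ! (k - 1) + Suc r * y) ((?B1 @ ?B2) ! (k - 1) + r * y)"
      by (intro adjacent_in_zigzag2_down) auto
    moreover have "(?B1 @ ?B2) ! (k - 1) = y + 1 - k" unfolding B using k by simp
    ultimately show ?thesis unfolding zigzag_short_first_def by (intro adjacent_in_Cons) simp
  qed
  moreover have "linear_length (y + 1 - k + Suc r * y) (y + 1 - k + r * y) = y"
    by (simp add: linear_length_def)
  moreover have "linear_length (y + 1 - k + Suc r * y) (1 + Suc (Suc r) * y) = k"
    using k by (simp add: linear_length_def)
  ultimately show ?thesis
    using std_realizable_rotate[of ?p "y + 1 - k + Suc r * y" "y + 1 - k + r * y"
        "replicate_mset (y - 1) 1 + replicate_mset c y"] p by (simp add: lengths_upt)
qed

subsection \<open>Two lengths\<close>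

lemma std_realizable_even_residue:
  assumes "0 < y" "even (c mod y)"
  shows "std_realizable (replicate_mset (y - 1) 1 + replicate_mset c y)"
  using std_realizable_tall_first[of y c "[0..<y]"] split_path_upt[of y "c mod y"] assms
  by (simp add: lengths_upt)

text \<open>With \<open>q = 1\<close> the first block consists of single vertices, so it fits for
  either parity of \<open>T = y + 1 - c\<close>. For \<open>c = 0\<close> this value would exceed
  \<open>y\<close>.\<close>

lemma std_realizable_less:
  assumes "c < y"
  shows "std_realizable (replicate_mset (y - 1) 1 + replicate_mset c y)"
proof (cases "c = 0")
  case True
  then show ?thesis using std_realizable_even_residue[of y c] assms by simp
next
  case False
  then show ?thesis
    using std_realizable_short_first[of y "y + 1 - c" "[0..<y]" 1 c]
      split_path_upt[of y "y + 1 - c"] assms by (simp add: lengths_upt)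
qed

lemma std_realizable_extra_odd:
  assumes "odd y" "odd (c mod y)" "y \<le> c" "odd k" "k < y"
  shows "std_realizable (add_mset k (replicate_mset (y - 1) 1 + replicate_mset c y))"
proof -
  \<comment> \<open>Equality with \<open>y\<close> is excluded by parity, so
    \<open>Suc c mod y\<close> is the even number \<open>c mod y + 1\<close>.\<close>
  have "c mod y < y" "Suc (c mod y) \<noteq> y"
    using assms by (simp add: odd_pos, metis even_Suc)
  then have "Suc c mod y = Suc (c mod y)" by (simp add: mod_Suc)
  moreover have "split_path y (Suc c mod y) [0..<y]"
    using assms by (intro split_path_upt) (auto simp: odd_pos)
  moreover have "\<forall>l\<in>#lengths [0..<y]. odd l" by (simp add: lengths_upt)
  moreover have "k \<le> last [0..<y]" using \<open>k < y\<close> by simp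
  ultimately show ?thesis
    using std_realizable_rotated[of y "Suc c mod y" "[0..<y]" c k] assms
    by (simp add: lengths_upt odd_pos)
qed

text \<open>For odd \<open>k\<close> a path that begins with the tall columns is rotated, for even
  \<open>k\<close> one that begins with the short columns.\<close>

lemma std_realizable_extra:
  assumes "odd y" "odd (c mod y)" "y \<le> c" "0 < k" "k < y"
  shows "std_realizable (add_mset k (replicate_mset (y - 1) 1 + replicate_mset c y))"
proof (cases "odd k")
  case True
  then show ?thesis using std_realizable_extra_odd assms by blast
next
  case False
  have "c div y \<ge> 1" using assms div_le_mono[of y c y] by simp
  then obtain r where r: "c div y = Suc r" by (cases "c div y") auto
  have "c mod y < y" using assms by simp
  then have "y - c mod y + c = Suc (Suc r) * y" using div_mult_mod_eq[of c y] r by simp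
  moreover have "0 < c mod y" using assms(2) by (rule odd_pos)
  ultimately show ?thesis
    using std_realizable_rotated_even[of y "y - c mod y" c r k] assms False \<open>c mod y < y\<close> by simp
qed

text \<open>A threshold uniform in the multiplicity \<open>b\<close>; larger numbers of ones then
  work too, because ones can be attached at the start of a path.\<close>

definition ones_suffice :: "nat \<Rightarrow> nat \<Rightarrow> bool" where
  "ones_suffice x k \<longleftrightarrow> (\<forall>b. std_realizable (replicate_mset k 1 + replicate_mset b x))"

lemma std_realizable_add_ones:
  assumes "std_realizable (replicate_mset k 1 + M)" "k \<le> a"
  shows "std_realizable (replicate_mset a 1 + M)"
proof -
  have "replicate_mset a (1::nat) = replicate_mset k 1 + replicate_mset (a - k) 1"
    using assms(2) by (simp flip: replicate_mset_add)
  then show ?thesis using std_realizable_ones[OF assms(1), of "a - k"] by (simp add: ac_simps)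
qed

lemma ones_sufficeD:
  "ones_suffice x k \<Longrightarrow> k \<le> a \<Longrightarrow> std_realizable (replicate_mset a 1 + replicate_mset b x)"
  using std_realizable_add_ones unfolding ones_suffice_def by blast

text \<open>For an odd residue of \<open>b\<close> the short columns come first, with
  \<open>T = x + 1 - b mod x\<close>, which is even because \<open>x\<close> is.\<close>

lemma ones_suffice_even:
  assumes "even x" "0 < x"
  shows "ones_suffice x (x - 1)"
  unfolding ones_suffice_def
proof
  fix b
  show "std_realizable (replicate_mset (x - 1) 1 + replicate_mset b x)"
  proof (cases "even (b mod x)")
    case True
    then show ?thesis using std_realizable_even_residue assms by blast
  next
    case False
    have "b mod x < x" "0 < b mod x" using assms False by (auto intro: odd_pos)
    moreover from this have "0 < x + 1 - b mod x" by linarith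
    moreover from calculation have "x + 1 - b mod x \<le> x" by linarith
    moreover from calculation have "x + 1 - b mod x + b = Suc (b div x) * x + 1"
      unfolding mult_Suc using div_mult_mod_eq[of b x] by linarith
    ultimately show ?thesis
      using std_realizable_short_first[of x "x + 1 - b mod x" "[0..<x]" "Suc (b div x)" b]
        split_path_upt[of x "x + 1 - b mod x"] assms False by (simp add: lengths_upt)
  qed
qed

text \<open>The only odd residue is 1. Then all three columns are short, and no second block has to
  be reached.\<close>

lemma ones_suffice_3: "ones_suffice 3 2"
  unfolding ones_suffice_def
proof
  fix b :: nat
  show "std_realizable (replicate_mset 2 1 + replicate_mset b 3)"
  proof (cases "even (b mod 3)")
    case True
    then show ?thesis using std_realizable_even_residue[of 3 b] by simp
  next
    case False
    then have "b mod 3 = 1" by presburger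
    then have "3 + b = Suc (b div 3) * 3 + 1" using div_mult_mod_eq[of b 3] by simp
    then show ?thesis
      using std_realizable_short_first[of 3 3 "[0..<3]" "Suc (b div 3)" b] split_path_upt[of 3 3]
      by (simp add: lengths_upt)
  qed
qed

text \<open>The remaining case, an odd residue of \<open>b\<close> with \<open>x \<le> b\<close>, is
  repaired by a rotation whose new edge has length 1.\<close>

lemma ones_suffice_odd:
  assumes "odd x"
  shows "ones_suffice x x"
  unfolding ones_suffice_def
proof
  fix b
  show "std_realizable (replicate_mset x 1 + replicate_mset b x)"
  proof (cases "even (b mod x) \<or> b < x")
    case True
    then have "std_realizable (replicate_mset (x - 1) 1 + replicate_mset b x)"
      using std_realizable_even_residue std_realizable_less assms odd_pos by blast
    then show ?thesis by (rule std_realizable_add_ones) simp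
  next
    case False
    obtain k where x: "x = Suc k" using assms by (cases x) auto
    show ?thesis
    proof (cases "x = 1")
      case False
      then show ?thesis
        using std_realizable_extra[of x b 1] assms \<open>\<not> (even (b mod x) \<or> b < x)\<close> x by simp
    qed (use False in simp)
  qed
qed

text \<open>A path with the edges of length \<open>y\<close> and \<open>y - 1\<close> ones is joined
  to one with the edges of length \<open>x\<close> and the other ones, at least \<open>k\<close>. If
  the first path needs an additional edge, it gets length \<open>x\<close> instead of 1, which keeps
  the bound at \<open>k + y - 1\<close>.\<close>

lemma realizable_two_blocks:
  assumes x: "ones_suffice x k" and "1 \<le> k" "1 < x" "x < y" and a: "k + y - 1 \<le> a"
  shows "has_linear_realization (replicate_mset a 1 + replicate_mset b x + replicate_mset c y)"
proof -
  have a_eq: "replicate_mset a (1::nat) = replicate_mset (a - (y - 1)) 1 + replicate_mset (y - 1) 1"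
    using a \<open>1 \<le> k\<close> by (simp flip: replicate_mset_add)
  show ?thesis
  proof (cases "odd y \<and> odd (c mod y) \<and> y \<le> c")
    case False
    have "ones_suffice y (y - 1) \<or> even (c mod y) \<or> c < y"
      using False ones_suffice_even[of y] assms by auto
    then have "std_realizable (replicate_mset (y - 1) 1 + replicate_mset c y)"
      using std_realizable_even_residue[of y c] std_realizable_less[of c y] assms
      unfolding ones_suffice_def by auto
    moreover have "std_realizable (replicate_mset (a - (y - 1)) 1 + replicate_mset b x)"
      by (rule ones_sufficeD[OF x]) (use a \<open>x < y\<close> in simp)
    ultimately have "has_linear_realization
        ((replicate_mset (y - 1) 1 + replicate_mset c y) +
          (replicate_mset (a - (y - 1)) 1 + replicate_mset b x))"
      by (rule realization_join)
    then show ?thesis unfolding a_eq by (simp add: ac_simps)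
  next
    case True
    show ?thesis
    proof (cases b)
      \<comment> \<open>Without edges of length \<open>x\<close> the additional edge is a 1;
        \<open>1 \<le> k\<close> provides the \<open>y\<close> ones.\<close>
      case 0
      have "std_realizable (replicate_mset a 1 + replicate_mset c y)"
        by (rule ones_sufficeD[OF ones_suffice_odd]) (use True a \<open>1 \<le> k\<close> in auto)
      then show ?thesis using 0 std_realizable_imp by simp
    next
      case (Suc b')
      have "std_realizable (add_mset x (replicate_mset (y - 1) 1 + replicate_mset c y))"
        using std_realizable_extra True assms by simp
      moreover have "std_realizable (replicate_mset (a - (y - 1)) 1 + replicate_mset b' x)"
        by (rule ones_sufficeD[OF x]) (use a \<open>x < y\<close> in simp)
      ultimately have "has_linear_realization
          (add_mset x (replicate_mset (y - 1) 1 + replicate_mset c y) +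
            (replicate_mset (a - (y - 1)) 1 + replicate_mset b' x))"
        by (rule realization_join)
      then show ?thesis unfolding a_eq Suc by (simp add: ac_simps)
    qed
  qed
qed

subsection \<open>Few edges of length 1\<close>

text \<open>The end \<open>T\<close> will be the start of a path through the vertices from
  \<open>T\<close> on, so that all vertices below \<open>T\<close> come first.\<close>

definition crossing :: "nat \<Rightarrow> nat \<Rightarrow> nat \<Rightarrow> bool" where
  "crossing x T k \<longleftrightarrow> (\<exists>p m. std_path p \<and> length p = Suc T \<and> last p = T \<and>
    lengths p = replicate_mset k 1 + replicate_mset m x)"

lemma crossing_ones: "crossing x T T"
  unfolding crossing_def
  by (intro exI[of _ "[0..<Suc T]"] exI[of _ 0])
    (auto simp: std_path_def lengths_upt lessThan_atLeast0 hd_append simp del: upt_Suc)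

lemma crossing_Suc:
  assumes "crossing x T k"
  shows "crossing x (Suc T) (Suc k)"
proof -
  obtain p m where p: "std_path p" "length p = Suc T" "last p = T"
      "lengths p = replicate_mset k 1 + replicate_mset m x"
    using assms by (auto simp: crossing_def)
  have "p \<noteq> []" using p by auto
  then show ?thesis unfolding crossing_def
    using p std_path_Cons_Suc[of p] lengths_Cons_Suc[of p]
    by (intro exI[of _ "0 # map Suc p"] exI[of _ m]) (simp add: last_map)
qed

lemma crossing_add: "crossing x T k \<Longrightarrow> crossing x (T + j) (k + j)"
  by (induction j) (auto intro: crossing_Suc)

text \<open>The \<open>x\<close> columns modulo \<open>x\<close> have height \<open>q\<close> and
  are visited in order. As \<open>x\<close> is odd, the last one is climbed, up to the largest
  vertex.\<close>

lemma crossing_full: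
  assumes "odd x" "0 < q"
  shows "crossing x (q * x - 1) (x - 1)"
proof -
  have "0 < x" using assms odd_pos by blast
  let ?p = "zigzag_tall_first x q 0 [0..<x]"
  obtain c where c: "q * x = c + x" using assms by (cases q) auto
  have p: "std_path ?p" "lengths ?p = lengths [0..<x] + replicate_mset c x"
    using zigzag_tall_first[of x 0 "[0..<x]" q c] split_path_upt[of x 0] \<open>0 < x\<close> assms c by auto
  have "length ?p = q * x" by (simp add: zigzag_tall_first_def)
  moreover have "last ?p = q * x - 1"
    using last_zigzag2[of q "[0..<x]" x "Suc q" "[]"] assms \<open>0 < x\<close>
    by (cases q) (simp_all add: zigzag_tall_first_def)
  ultimately show ?thesis
    using p \<open>0 < x\<close> assms unfolding crossing_def
    by (intro exI[of _ ?p] exI[of _ c]) (simp add: lengths_upt)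
qed

text \<open>After \<open>0\<close> come the columns at \<open>x\<close>, \<open>x - 1\<close>, ...,
  \<open>1\<close>, all of height \<open>q\<close>. As \<open>x\<close> is odd, the last one is
  climbed to \<open>1 + (q - 1) * x\<close>, from where one more edge of length \<open>x\<close>
  reaches the new vertex \<open>q * x + 1\<close>.\<close>

lemma crossing_link:
  assumes "odd x" "0 < q"
  shows "crossing x (q * x + 1) (x - 1)"
proof -
  have "0 < x" using assms odd_pos by blast
  let ?p = "zigzag_short_first x q x [0..<x]"
  obtain c where c: "q * x = c + x" using assms by (cases q) auto
  have p: "std_path ?p" "lengths ?p = lengths [0..<x] + replicate_mset (Suc c) x"
    using zigzag_short_first[of x x "[0..<x]" q "Suc c"] split_path_upt[of x x] \<open>0 < x\<close> assms c
    by auto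
  have len: "length ?p = Suc (q * x)" by (simp add: zigzag_short_first_def)
  have "zigzag2 x q (map ((-) x) [0..<x]) (Suc q) [] \<noteq> []"
    using \<open>0 < x\<close> assms by (simp add: zigzag2_def)
  then have "last ?p = Suc c"
    using last_zigzag[of q "map ((-) x) [0..<x]" True x] assms \<open>0 < x\<close> c
    by (cases q) (simp_all add: zigzag_short_first_def zigzag2_def last_map)
  moreover have "?p \<noteq> []" using len by auto
  ultimately have "lengths (?p @ [Suc (q * x)]) = replicate_mset (x - 1) 1 + replicate_mset (Suc (Suc c)) x"
    using p(2) c by (simp add: lengths_append lengths_upt)
  moreover have "std_path (?p @ [Suc (q * x)])"
    using p(1) unfolding std_path_def by (simp add: len lessThan_Suc)
  ultimately show ?thesis
    unfolding crossing_def using len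
    by (intro exI[of _ "?p @ [Suc (q * x)]"] exI[of _ "Suc (Suc c)"]) simp
qed

text \<open>If \<open>x\<close> divides \<open>T\<close>, one edge of length 1 is added to a full
  grid; otherwise \<open>T mod x - 1\<close> of them are added to the crossing with end
  \<open>(T div x) * x + 1\<close>.\<close>

lemma crossing_minimal:
  assumes "odd x" "x \<le> T"
  shows "crossing x T (if x dvd T then x else x - 2 + T mod x)"
proof (cases "x dvd T")
  case True
  then obtain q where q: "T = q * x" by (metis dvd_def mult.commute)
  have "0 < x" using assms odd_pos by blast
  then have "0 < q" using q assms by (cases q) auto
  then show ?thesis using crossing_Suc[OF crossing_full[of x q]] assms q \<open>0 < x\<close> True by simp
next
  case False
  have "1 < x" using False assms odd_pos[of x] by (cases "x = 1") auto
  have "0 < T mod x" using False by (simp add: mod_greater_zero_iff_not_dvd)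
  moreover have "0 < T div x" using assms \<open>1 < x\<close> by (simp add: div_greater_zero_iff)
  ultimately show ?thesis
    using crossing_add[OF crossing_link[of x "T div x"], of "T mod x - 1"] assms \<open>1 < x\<close> False
      div_mult_mod_eq[of T x] by (simp add: numeral_2_eq_2)
qed

section \<open>Orders of the residues modulo \<open>y\<close> with few steps of length 1\<close>

definition split_realizable :: "nat \<Rightarrow> nat \<Rightarrow> nat \<Rightarrow> nat \<Rightarrow> bool" where
  "split_realizable x y T n \<longleftrightarrow>
    (\<exists>s m. split_path y T s \<and> lengths s = replicate_mset n 1 + replicate_mset m x \<and> n + m + 1 = y)"

lemma split_realizable_whole:
  assumes "ones_suffice x k" "k \<le> n" "n < y" "T = 0 \<or> T = y"
  shows "split_realizable x y T n"
proof -
  obtain s where s: "std_path s" "lengths s = replicate_mset n 1 + replicate_mset (y - 1 - n) x"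
    using ones_sufficeD[OF assms(1,2)] unfolding std_realizable_def by blast
  then have "s \<noteq> []" by (auto simp: std_path_def)
  then have len: "length s = y" using length_eq_size_lengths[of s] s(2) assms(3) by simp
  then have "split_path y T s" using split_path_whole[OF s(1), of T] assms(4) by simp
  then show ?thesis unfolding split_realizable_def
    using s(2) assms(3) by (intro exI[of _ s] exI[of _ "y - 1 - n"]) simp
qed

text \<open>A crossing to \<open>T\<close> is followed by a path through the remaining
  \<open>y - T\<close> vertices. That path has either at least \<open>k\<close> ones or, when
  \<open>T + j + 1 = y\<close>, nothing but ones.\<close>

lemma split_realizable_crossing:
  assumes T: "crossing x T t" and x: "ones_suffice x k" and "T < y"
    and j: "k \<le> j \<and> T + j < y \<or> T + j + 1 = y"
  shows "split_realizable x y T (t + j)"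
proof -
  obtain p m where p: "std_path p" "length p = Suc T" "last p = T"
      "lengths p = replicate_mset t 1 + replicate_mset m x"
    using T by (auto simp: crossing_def)
  have "std_realizable (replicate_mset j 1 + replicate_mset (y - T - 1 - j) x)"
  proof (cases "T + j + 1 = y")
    case True
    have "std_path [0..<Suc j]" by (auto simp: std_path_def lessThan_atLeast0 hd_append)
    then show ?thesis using True lengths_upt[of "Suc j"] by (auto simp: std_realizable_def)
  next
    case False
    then show ?thesis using ones_sufficeD[OF x] j by blast
  qed
  then obtain r where r: "std_path r" "lengths r = replicate_mset j 1 + replicate_mset (y - T - 1 - j) x"
    by (auto simp: std_realizable_def)
  have "r \<noteq> []" "hd r = 0" using r by (auto simp: std_path_def)
  then obtain r0 where r0: "r = 0 # r0" by (cases r) auto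
  have lenr: "T + length r = y" using length_eq_size_lengths[OF \<open>r \<noteq> []\<close>] r(2) j \<open>T < y\<close> by auto
  define s where "s = butlast p @ map ((+) T) r"
  have "p \<noteq> []" using p by auto
  then have p_eq: "p = butlast p @ [T]" using p(3) by (metis append_butlast_last_id)
  have "distinct p" using p(1) by (rule std_path_distinct)
  then have "T \<notin> set (butlast p)" "insert T (set (butlast p)) = {..<Suc T}"
    using p(1,2) arg_cong[OF p_eq, of distinct] arg_cong[OF p_eq, of set] by (auto simp: std_path_def)
  then have setp: "set (butlast p) = {..<T}" unfolding lessThan_Suc by (auto dest: equalityD1)
  have lens: "length s = y" using lenr p(2) by (simp add: s_def)
  have "set (map ((+) T) r) = {T..<y}"
  proof -
    have "set (map ((+) T) r) = (+) T ` {0..<length r}"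
      using r(1) by (simp add: std_path_def lessThan_atLeast0)
    also have "\<dots> = {T..<y}" using lenr by (simp add: add.commute)
    finally show ?thesis .
  qed
  then have "set s = {..<y}" using setp \<open>T < y\<close> unfolding s_def by auto
  moreover have "hd s = 0"
  proof (cases "butlast p = []")
    case True
    then have "p = [T]" using p_eq by simp
    then show ?thesis using p(1) True r0 by (simp add: std_path_def s_def)
  next
    case False
    have "hd p = hd (butlast p)" using p_eq False by (metis hd_append2)
    then show ?thesis using p(1) False by (simp add: std_path_def s_def)
  qed
  moreover have "take T s = butlast p" using p(2) by (simp add: s_def)
  ultimately have "split_path y T s"
    using lens setp \<open>T < y\<close> by (auto simp: split_path_def std_path_def)
  moreover have "lengths s = lengths p + lengths r"
  proof (cases "r0 = []")
    case True
    then show ?thesis using p_eq r0 by (simp add: s_def)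
  next
    case False
    have "s = p @ map ((+) T) r0" using p_eq r0 by (simp add: s_def)
    then have "lengths s = lengths p + lengths (map ((+) T) r0) + {#linear_length T (T + hd r0)#}"
      using lengths_append[of p "map ((+) T) r0"] p(3) \<open>p \<noteq> []\<close> False by (simp add: hd_map)
    moreover have "lengths r = lengths r0 + {#linear_length 0 (hd r0)#}"
      using False r0 by (cases r0) auto
    ultimately show ?thesis using linear_length_shift(2)[of T 0 "hd r0"] by simp
  qed
  then have lens': "lengths s = replicate_mset (t + j) 1 + replicate_mset (m + (y - T - 1 - j)) x"
    using p(4) r(2) by (simp add: replicate_mset_add)
  moreover have "t + j + (m + (y - T - 1 - j)) + 1 = y"
    using size_lengths[of s] lens \<open>T < y\<close> unfolding lens' by simp
  ultimately show ?thesis unfolding split_realizable_def by blast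
qed

text \<open>The window for \<open>n\<close> comes from its use: the lower bound leaves at most
  \<open>y - 2 * x + 2\<close> edges of length \<open>x\<close>, the upper one saves
  \<open>k\<close> ones for the path that is joined.\<close>

lemma split_realizable_exists:
  assumes x: "odd x" "3 \<le> x" "ones_suffice x k" "x - 1 \<le> k" "k \<le> x" "2 * k + x - 1 \<le> y"
    and "T < y"
  shows "\<exists>n. 2 * x - 3 \<le> n \<and> n \<le> 2 * x - 3 + k \<and> split_realizable x y T n"
proof -
  note cross = split_realizable_crossing[OF _ x(3) \<open>T < y\<close>]
  consider "T = 0" | "0 < T" "T < x" | "x \<le> T" by linarith
  then show ?thesis
  proof cases
    case 1
    then show ?thesis
      using split_realizable_whole[OF x(3), of "2 * x - 3" y T] x by (intro exI[of _ "2 * x - 3"]) auto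
  next
    case 2
    \<comment> \<open>The crossing consists of ones here; the maximum respects the threshold
      \<open>k\<close> and lifts \<open>T + j\<close> to \<open>2 * x - 3\<close>.\<close>
    define j where "j = max k (2 * x - 3 - T)"
    have "k \<le> j" "T + j < y" using x 2 by (auto simp: j_def)
    then have "split_realizable x y T (T + j)" using cross[OF crossing_ones] by blast
    moreover have "2 * x - 3 \<le> T + j" "T + j \<le> 2 * x - 3 + k" using 2 x by (auto simp: j_def)
    ultimately show ?thesis by blast
  next
    case 3
    define t where "t = (if x dvd T then x else x - 2 + T mod x)"
    have t: "crossing x T t" using crossing_minimal[OF x(1) 3] by (simp add: t_def)
    have modx: "T mod x < x" using x by simp
    have t_bounds: "x - 1 \<le> t" "t \<le> 2 * x - 3"
    proof (atomize (full), cases "x dvd T")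
      case True
      then show "x - 1 \<le> t \<and> t \<le> 2 * x - 3" using x by (simp add: t_def)
    next
      case False
      then have "0 < T mod x" by (simp add: mod_greater_zero_iff_not_dvd)
      moreover have "t = x - 2 + T mod x" using False by (simp add: t_def)
      ultimately show "x - 1 \<le> t \<and> t \<le> 2 * x - 3" using modx x by linarith
    qed
    define j where "j = y - T - 1"
    have j: "T + j + 1 = y" using \<open>T < y\<close> by (simp add: j_def)
    consider "k \<le> j" | "j < k" "2 * x - 3 \<le> t + j" | "j < k" "t + j < 2 * x - 3" by linarith
    then show ?thesis
    proof cases
      case 1
      then have "split_realizable x y T (t + k)" using cross[OF t] j by simp
      then show ?thesis using t_bounds x by (intro exI[of _ "t + k"]) auto
    next
      case 2
      then have "split_realizable x y T (t + j)" using cross[OF t] j by blast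
      then show ?thesis using 2 t_bounds x by (intro exI[of _ "t + j"]) auto
    next
      case 3
      \<comment> \<open>For smaller \<open>T\<close> almost every step would be a 1, so
        \<open>t + j\<close> would be large. Now \<open>T - x\<close> has the same residue and the
        same crossing cost \<open>t\<close>, and \<open>x\<close> further ones lead to
        \<open>T\<close>.\<close>
      have "2 * x \<le> T"
      proof (rule ccontr)
        assume "\<not> 2 * x \<le> T"
        then have "T mod x = T - x" using \<open>x \<le> T\<close> by (simp add: le_mod_geq)
        then have "t = T - 2 \<or> T = x \<and> t = x"
          using \<open>x \<le> T\<close> x by (auto simp: t_def dvd_eq_mod_eq_0)
        then show False using 3 x j by linarith
      qed
      then have "x \<le> T - x" by simp
      moreover have "T mod x = (T - x) mod x" using \<open>x \<le> T\<close> by (rule le_mod_geq)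
      ultimately have "crossing x (T - x) t"
        using crossing_minimal[OF x(1), of "T - x"]
        by (auto simp: t_def dvd_eq_mod_eq_0 split: if_splits)
      then have "crossing x T (t + x)" using crossing_add[of x "T - x" t x] \<open>x \<le> T\<close> by simp
      then have "split_realizable x y T (t + x + j)" using cross[of "t + x" j] j by blast
      then show ?thesis using 3 t_bounds x by (intro exI[of _ "t + x + j"]) auto
    qed
  qed
qed

lemma realizable_append:
  assumes "std_realizable (replicate_mset n 1 + replicate_mset m x + replicate_mset c y)"
    and "ones_suffice x k" "n + k \<le> a" "m \<le> b"
  shows "has_linear_realization (replicate_mset a 1 + replicate_mset b x + replicate_mset c y)"
proof -
  have "std_realizable (replicate_mset (a - n) 1 + replicate_mset (b - m) x)"
    by (rule ones_sufficeD[OF assms(2)]) (use assms(3) in simp)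
  note J = realization_join[OF assms(1) this]
  have "replicate_mset a (1::nat) = replicate_mset n 1 + replicate_mset (a - n) 1"
    "replicate_mset b x = replicate_mset m x + replicate_mset (b - m) x"
    using assms by (simp_all flip: replicate_mset_add)
  then show ?thesis using J by (simp add: ac_simps)
qed

text \<open>For large \<open>a\<close> two blocks suffice; otherwise \<open>y\<close> is large
  enough for the window of \<open>n\<close>. Then \<open>c\<close> decides between tall columns
  first, a rotation, and columns of height 1 first.\<close>

lemma realizable_few_ones:
  assumes x: "odd x" "3 \<le> x" "ones_suffice x k" "x - 1 \<le> k" "k \<le> x"
    and "x < y" and a: "2 * x - 3 + 2 * k \<le> a" and b: "y + 2 \<le> b + 2 * x"
  shows "has_linear_realization (replicate_mset a 1 + replicate_mset b x + replicate_mset c y)"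
proof (cases "k + y - 1 \<le> a")
  case True
  then show ?thesis using realizable_two_blocks[OF x(3)] assms by simp
next
  case False
  then have y: "2 * k + x - 1 \<le> y" "2 * x \<le> y" using assms by auto
  note ex = split_realizable_exists[OF x y(1)]
  consider "even (c mod y)" | "odd (c mod y)" "y \<le> c" | "odd (c mod y)" "c < y" by linarith
  then show ?thesis
  proof cases
    case 1
    obtain n where n: "2 * x - 3 \<le> n" "n \<le> 2 * x - 3 + k" "split_realizable x y (c mod y) n"
      using ex[of "c mod y"] \<open>x < y\<close> by auto
    then obtain s m where s: "split_path y (c mod y) s"
        "lengths s = replicate_mset n 1 + replicate_mset m x" "n + m + 1 = y"
      by (auto simp: split_realizable_def)
    show ?thesis
      using realizable_append[OF _ x(3), of n m c y a b] n s a b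
        std_realizable_tall_first[OF s(1)] 1 \<open>x < y\<close> by simp
  next
    case 2
    define T where "T = Suc c mod y"
    have "T < y" using \<open>x < y\<close> by (simp add: T_def)
    have "even T" using 2 unfolding T_def mod_Suc by auto
    obtain n where n: "2 * x - 3 \<le> n" "n \<le> 2 * x - 3 + k" "split_realizable x y T n"
      using ex[OF \<open>T < y\<close>] by auto
    then obtain s m where s: "split_path y T s"
        "lengths s = replicate_mset n 1 + replicate_mset m x" "n + m + 1 = y"
      by (auto simp: split_realizable_def)
    have odd: "\<forall>l\<in>#lengths s. odd l" using x(1) by (auto simp: s)
    note R = std_realizable_rotated[OF s(1) T_def \<open>even T\<close> \<open>y \<le> c\<close> _ odd]
    \<comment> \<open>At the lower end of the window an edge of length \<open>x\<close> might be
      lacking, so the rotation creates a 1. Elsewhere it creates an \<open>x\<close>, because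
      \<open>n\<close> may be at the upper end.\<close>
    show ?thesis
    proof (cases "n = 2 * x - 3")
      case True
      have "std_realizable (add_mset 1 (lengths s + replicate_mset c y))"
        using R[of 1] y x by (cases "last s") auto
      then have "std_realizable (replicate_mset (Suc n) 1 + replicate_mset m x + replicate_mset c y)"
        by (simp add: s)
      then show ?thesis
        by (rule realizable_append[OF _ x(3)]) (use True s(3) x a b in auto)
    next
      case False
      have "std_realizable (add_mset x (lengths s + replicate_mset c y))"
        using R[of x] y x by fastforce
      then have "std_realizable (replicate_mset n 1 + replicate_mset (Suc m) x + replicate_mset c y)"
        by (simp add: s)
      then show ?thesis
        by (rule realizable_append[OF _ x(3)]) (use False n s(3) x a b in auto)
    qed
  next
    case 3
    define T where "T = y + 1 - c"
    have "0 < c" using 3 by (auto intro: Nat.gr0I)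
    then have T: "0 < T" "T \<le> y" "T + c = 1 * y + 1" using 3 by (auto simp: T_def)
    obtain n where n: "2 * x - 3 \<le> n" "n \<le> 2 * x - 3 + k" "split_realizable x y T n"
    proof (cases "T = y")
      case True
      then show ?thesis
        using that[of "2 * x - 3"] split_realizable_whole[OF x(3), of "2 * x - 3" y T] x y by simp
    next
      case False
      then show ?thesis using that ex[of T] T by auto
    qed
    then obtain s m where s: "split_path y T s"
        "lengths s = replicate_mset n 1 + replicate_mset m x" "n + m + 1 = y"
      by (auto simp: split_realizable_def)
    have "std_realizable (lengths s + replicate_mset c y)"
      by (rule std_realizable_short_first[OF s(1) T(1,2) _ T(3)]) auto
    then have "std_realizable (replicate_mset n 1 + replicate_mset m x + replicate_mset c y)"
      by (simp add: s)
    then show ?thesis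
      by (rule realizable_append[OF _ x(3)]) (use n s(3) x a b in auto)
  qed
qed

subsection \<open>Columns traversed in pairs\<close>

definition row_path :: "nat \<Rightarrow> nat \<Rightarrow> nat \<Rightarrow> nat list \<Rightarrow> bool" where
  "row_path t h g r \<longleftrightarrow> std_path r \<and> length r = h \<and>
    (\<exists>m. lengths r = replicate_mset m 1 + replicate_mset g t)"

lemma row_path_upt: "0 < h \<Longrightarrow> row_path t h 0 [0..<h]"
  by (auto simp: row_path_def std_path_def lengths_upt)

text \<open>The two bounds reflect that \<open>t - 1\<close> ones suffice for \<open>g < t\<close>,
  and \<open>t\<close> ones in general.\<close>

lemma row_path_exists:
  assumes "odd t" "g < t \<and> g + t \<le> h \<or> g + t + 1 \<le> h"
  shows "\<exists>r. row_path t h g r"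
proof -
  have "0 < t" using assms(1) by (rule odd_pos)
  have "std_realizable (replicate_mset (h - 1 - g) 1 + replicate_mset g t)"
  proof (cases "g < t")
    case True
    show ?thesis
      by (rule std_realizable_add_ones[OF std_realizable_less[OF True]]) (use assms(2) in auto)
  next
    case False
    show ?thesis
      by (rule ones_sufficeD[OF ones_suffice_odd[OF assms(1)]]) (use assms(2) False in auto)
  qed
  then obtain r where r: "std_path r" "lengths r = replicate_mset (h - 1 - g) 1 + replicate_mset g t"
    by (auto simp: std_realizable_def)
  moreover have "r \<noteq> []" using r(1) by (simp add: std_path_def)
  then have "length r = h"
    using length_eq_size_lengths[of r] r(2) assms(2) \<open>0 < t\<close> by auto
  ultimately show ?thesis unfolding row_path_def by blast
qed

lemma crossing_row_path:
  assumes "crossing t h k" "k + g = h"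
  shows "\<exists>r. row_path t (Suc h) g r \<and> last r = h"
proof -
  obtain r m where r: "std_path r" "length r = Suc h" "last r = h"
      "lengths r = replicate_mset k 1 + replicate_mset m t"
    using assms(1) by (auto simp: crossing_def)
  then have "m = g" using size_lengths[of r] assms(2) by simp
  then show ?thesis using r by (auto simp: row_path_def)
qed

text \<open>A crossing to \<open>Suc j * t - 1\<close> has \<open>t - 1\<close> ones and hence
  \<open>j * t\<close> edges of length \<open>t\<close>; additional ones move its end to
  \<open>h\<close>.\<close>

lemma row_path_multiple:
  assumes "odd t" "Suc j * t \<le> Suc h"
  shows "\<exists>r. row_path t (Suc h) (j * t) r \<and> last r = h"
proof (rule crossing_row_path)
  have "0 < t" using assms(1) by (rule odd_pos)
  then show "crossing t h (t - 1 + (Suc h - Suc j * t))"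
    using crossing_add[OF crossing_full[OF assms(1), of "Suc j"], of "Suc h - Suc j * t"] assms(2) by simp
  show "t - 1 + (Suc h - Suc j * t) + j * t = h" using assms(2) \<open>0 < t\<close> by simp
qed

definition row_column :: "nat \<Rightarrow> nat \<Rightarrow> nat list \<Rightarrow> nat list" where
  "row_column x i r = map (\<lambda>k. i + k * x) r"

lemma set_row_column: "set (row_column x i r) = {i + k * x |k. k \<in> set r}"
  by (auto simp: row_column_def)

lemma row_column_eq_Nil [simp]: "row_column x i r = [] \<longleftrightarrow> r = []"
  by (simp add: row_column_def)

lemma distinct_row_column: "0 < x \<Longrightarrow> distinct r \<Longrightarrow> distinct (row_column x i r)"
  by (simp add: row_column_def distinct_map inj_on_def)

lemma hd_row_column: "r \<noteq> [] \<Longrightarrow> hd (row_column x i r) = i + hd r * x"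
  by (simp add: row_column_def hd_map)

lemma last_row_column: "r \<noteq> [] \<Longrightarrow> last (row_column x i r) = i + last r * x"
  by (simp add: row_column_def last_map)

lemma lengths_row_column: "lengths (row_column x i r) = image_mset (\<lambda>l. l * x) (lengths r)"
  unfolding row_column_def
proof (rule lengths_map)
  fix u w
  have "\<bar>int (u * x) - int (w * x)\<bar> = \<bar>int u - int w\<bar> * int x"
    by (simp add: abs_mult flip: left_diff_distrib)
  then show "linear_length (i + u * x) (i + w * x) = linear_length u w * x"
    by (simp add: linear_length_def nat_mult_distrib)
qed

lemma lengths_row_path:
  assumes "row_path t h g r"
  shows "\<exists>m. lengths (row_column x i r) = replicate_mset m x + replicate_mset g (t * x)"
  using assms unfolding lengths_row_column by (auto simp: row_path_def)

lemma lengths_row_column_rev [simp]: "lengths (row_column x i (rev r)) = lengths (row_column x i r)"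
  by (simp add: lengths_row_column)

lemma row_pathD:
  assumes "row_path t h g r"
  shows "r \<noteq> []" "hd r = 0" "set r = {..<h}" "distinct r" "length r = h"
  using assms std_path_distinct by (auto simp: row_path_def std_path_def)

text \<open>The number \<open>m\<close> of edges of length \<open>x\<close> is left open because the number of vertices determines it.\<close>

definition column_path :: "nat \<Rightarrow> nat \<Rightarrow> (nat \<Rightarrow> nat) \<Rightarrow> nat \<Rightarrow> nat \<Rightarrow> nat \<Rightarrow> bool" where
  "column_path x y f i n g \<longleftrightarrow> (\<exists>p m. p \<noteq> [] \<and> hd p = i \<and> distinct p \<and>
    set p = {j + k * x |j k. i \<le> j \<and> j < x \<and> k < f j} \<and>
    lengths p = replicate_mset n 1 + replicate_mset m x + replicate_mset g y)"

lemma mod_row_column: "i < x \<Longrightarrow> v \<in> set (row_column x i r) \<Longrightarrow> v mod x = i"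
  by (auto simp: set_row_column)

lemma disjoint_row_columns:
  "i < x \<Longrightarrow> j < x \<Longrightarrow> i \<noteq> j \<Longrightarrow> set (row_column x i r) \<inter> set (row_column x j r') = {}"
  using mod_row_column by (metis disjoint_iff)

lemma linear_length_next_column [simp]:
  "linear_length (i + k) (Suc i + k) = 1" "linear_length (Suc i + k) (i + k) = 1"
  by (simp_all add: linear_length_def)

text \<open>The reversal of \<open>r\<close> starts in the second column at the height where
  \<open>r\<close> ended in the first, and it returns to the bottom, where the next column is
  entered. So the pair costs two edges of length 1, wherever \<open>r\<close> ends.\<close>

lemma column_path_pair:
  assumes p: "column_path x (t * x) f (Suc (Suc i)) n g" and r: "row_path t h g' r"
    and f: "f i = h" "f (Suc i) = h" and i: "Suc (Suc i) < x"
  shows "column_path x (t * x) f i (n + 2) (g + 2 * g')"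
proof -
  obtain p m where p: "p \<noteq> []" "hd p = Suc (Suc i)" "distinct p"
      "set p = {j + k * x |j k. Suc (Suc i) \<le> j \<and> j < x \<and> k < f j}"
      "lengths p = replicate_mset n 1 + replicate_mset m x + replicate_mset g (t * x)"
    using p by (auto simp: column_path_def)
  note r' = row_pathD[OF r]
  let ?c = "row_column x i r" and ?d = "row_column x (Suc i) (rev r)"
  obtain m1 where m1: "lengths ?c = replicate_mset m1 x + replicate_mset g' (t * x)"
    using lengths_row_path[OF r] by blast
  obtain m2 where m2: "lengths ?d = replicate_mset m2 x + replicate_mset g' (t * x)"
    using lengths_row_path[OF r] by fastforce
  have "lengths (?c @ ?d @ p) = lengths ?c + lengths ?d + lengths p + {#1, 1#}"
    using r'(1,2) p(1,2) linear_length_next_column(1)[of i "last r * x"]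
      linear_length_next_column(1)[of "Suc i" 0]
    by (simp add: lengths_append hd_row_column last_row_column hd_rev last_rev)
  then have "lengths (?c @ ?d @ p) = replicate_mset (n + 2) 1 + replicate_mset (m1 + m2 + m) x +
      replicate_mset (g + 2 * g') (t * x)"
    using m2 by (simp add: m1 p(5) replicate_mset_add mult_2)
  moreover have "distinct (?c @ ?d @ p)"
  proof -
    have "Suc (Suc i) \<le> v mod x" if "v \<in> set p" for v
      using that unfolding p(4) by auto
    then have "set ?c \<inter> set p = {}" "set ?d \<inter> set p = {}"
      using mod_row_column[of i x _ r] mod_row_column[of "Suc i" x _ "rev r"] i
      by (metis Suc_lessD Suc_n_not_le_n disjoint_iff le_SucI not_less_eq_eq)+
    moreover have "set ?c \<inter> set ?d = {}" using i by (intro disjoint_row_columns) auto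
    moreover have "distinct ?c" "distinct ?d" using r'(4) i by (auto intro: distinct_row_column)
    ultimately show ?thesis using p(3) by auto
  qed
  moreover have "set (?c @ ?d @ p) = {j + k * x |j k. i \<le> j \<and> j < x \<and> k < f j}" (is "?L = ?R")
  proof (intro equalityI subsetI)
    fix v assume "v \<in> ?R"
    then obtain j k where v: "v = j + k * x" "i \<le> j" "j < x" "k < f j" by blast
    then consider "j = i" | "j = Suc i" | "Suc (Suc i) \<le> j" by linarith
    then show "v \<in> ?L"
    proof cases
      case 3
      then have "v \<in> set p" unfolding p(4) using v by blast
      then show ?thesis by simp
    qed (use v f r'(3) in \<open>auto simp: set_row_column\<close>)
  next
    fix v assume "v \<in> ?L"
    then consider k where "v = i + k * x" "k < h" | k where "v = Suc i + k * x" "k < h" | "v \<in> set p"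
      using r'(3) by (auto simp: set_row_column)
    then show "v \<in> ?R"
    proof cases
      case 1
      then show ?thesis using i f by (intro CollectI exI[of _ i] exI[of _ k]) auto
    next
      case 2
      then show ?thesis using i f by (intro CollectI exI[of _ "Suc i"] exI[of _ k]) auto
    next
      case 3
      then show ?thesis unfolding p(4) using Suc_leD by blast
    qed
  qed
  moreover have "hd (?c @ ?d @ p) = i" using r'(1,2) by (simp add: hd_row_column)
  moreover have "?c @ ?d @ p \<noteq> []" using p(1) by simp
  ultimately show ?thesis
    unfolding column_path_def by (intro exI[of _ "?c @ ?d @ p"] exI[of _ "m1 + m2 + m"] conjI)
qed

text \<open>A column of height \<open>t + 1 + e\<close> takes any number up to \<open>e\<close> of
  edges of length \<open>t * x\<close>, and its partner the same number; the demand is met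
  greedily.\<close>

lemma column_path_pairs:
  assumes "column_path x (t * x) f (i + 2 * k) n g" "odd t"
    and "\<And>j. i \<le> j \<Longrightarrow> j < i + 2 * k \<Longrightarrow> f j = t + 1 + e" "i + 2 * k < x" "g' \<le> k * e"
  shows "column_path x (t * x) f i (n + 2 * k) (g + 2 * g')"
  using assms
proof (induction k arbitrary: i g')
  case (Suc k)
  define z where "z = min g' e"
  have "g' - z \<le> k * e" using Suc.prems(5) by (auto simp: z_def)
  then have "column_path x (t * x) f (Suc (Suc i)) (n + 2 * k) (g + 2 * (g' - z))"
    using Suc.prems by (intro Suc.IH) auto
  moreover obtain r where "row_path t (t + 1 + e) z r"
    using row_path_exists[OF \<open>odd t\<close>, of z "t + 1 + e"] by (auto simp: z_def)
  ultimately have "column_path x (t * x) f i (n + 2 * k + 2) (g + 2 * (g' - z) + 2 * z)"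
    using Suc.prems by (intro column_path_pair[of x t f i _ _ "t + 1 + e" z r]) auto
  moreover have "g + 2 * (g' - z) + 2 * z = g + 2 * g'" by (simp add: z_def)
  ultimately show ?case by simp
qed simp

lemma column_path_single:
  assumes "row_path t h g r" "f (x - 1) = h" "0 < x"
  shows "column_path x (t * x) f (x - 1) 0 g"
proof -
  note r = row_pathD[OF assms(1)]
  let ?p = "row_column x (x - 1) r"
  obtain m where "lengths ?p = replicate_mset m x + replicate_mset g (t * x)"
    using lengths_row_path[OF assms(1)] by blast
  moreover have "{j + k * x |j k. x - 1 \<le> j \<and> j < x \<and> k < f j} = {x - 1 + k * x |k. k < h}"
  proof (intro equalityI subsetI)
    fix v assume "v \<in> {j + k * x |j k. x - 1 \<le> j \<and> j < x \<and> k < f j}"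
    then obtain j k where "v = j + k * x" "x - 1 \<le> j" "j < x" "k < f j" by blast
    moreover from this have "j = x - 1" by linarith
    ultimately show "v \<in> {x - 1 + k * x |k. k < h}" using assms(2) by blast
  next
    fix v assume "v \<in> {x - 1 + k * x |k. k < h}"
    then obtain k where "v = x - 1 + k * x" "k < h" by blast
    then show "v \<in> {j + k * x |j k. x - 1 \<le> j \<and> j < x \<and> k < f j}"
      using assms(2,3) by (intro CollectI exI[of _ "x - 1"] exI[of _ k]) simp
  qed
  ultimately show ?thesis
    unfolding column_path_def
    using r assms by (intro exI[of _ ?p] exI[of _ m])
      (auto simp: distinct_row_column hd_row_column set_row_column)
qed

text \<open>The second column is left at the height \<open>m\<close> for a visit of the third one, which returns to
  the bottom of the second one. This costs a third edge of length \<open>1\<close>.\<close>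

lemma column_path_triple:
  assumes rows: "row_path t h1 g1 r1" "last r1 = h1 - 1" "row_path t h2 g2 r2" "last r2 = m"
      "row_path t m g3 r3"
    and m: "m < h1" and f: "f i = h1" "f (Suc i) = h1" "f (Suc (Suc i)) = h2" and x: "x = i + 3"
  shows "column_path x (t * x) f i 3 (g1 + g2 + g3)"
proof -
  note r1 = row_pathD[OF rows(1)] and r2 = row_pathD[OF rows(3)] and r3 = row_pathD[OF rows(5)]
  let ?c1 = "row_column x i r1" and ?c2 = "row_column x (Suc i) (rev [m..<h1])"
  let ?c3 = "row_column x (Suc (Suc i)) (rev r2)" and ?c4 = "row_column x (Suc i) r3"
  obtain m1 where m1: "lengths ?c1 = replicate_mset m1 x + replicate_mset g1 (t * x)"
    using lengths_row_path[OF rows(1)] by blast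
  obtain m3 where m3: "lengths ?c3 = replicate_mset m3 x + replicate_mset g2 (t * x)"
    using lengths_row_path[OF rows(3)] by fastforce
  obtain m4 where m4: "lengths ?c4 = replicate_mset m4 x + replicate_mset g3 (t * x)"
    using lengths_row_path[OF rows(5)] by blast
  have "[m..<h1] = map ((+) m) [0..<h1 - m]"
    using m map_add_upt[of m "h1 - m"] by (simp add: add.commute cong: map_cong)
  then have "lengths [m..<h1] = replicate_mset (h1 - m - 1) 1" by (simp only: lengths_map_add lengths_upt)
  then have m2: "lengths ?c2 = replicate_mset (h1 - m - 1) x" by (simp add: lengths_row_column)
  let ?p = "?c1 @ ?c2 @ ?c3 @ ?c4"
  have "lengths ?p = lengths ?c1 + lengths ?c2 + lengths ?c3 + lengths ?c4 + {#1, 1, 1#}"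
    using r1 r2 r3 m rows(2,4) linear_length_next_column(1)[of i "(h1 - 1) * x"]
      linear_length_next_column(1)[of "Suc i" "m * x"] linear_length_next_column(2)[of "Suc i" 0]
    by (simp add: lengths_append hd_row_column last_row_column hd_rev last_rev
        del: lengths_row_column_rev)
  then have "lengths ?p = replicate_mset 3 1 + replicate_mset (m1 + (h1 - m - 1) + m3 + m4) x +
      replicate_mset (g1 + g2 + g3) (t * x)"
    unfolding m1 m2 m3 m4 by (simp add: replicate_mset_add numeral_3_eq_3)
  moreover have "distinct ?p"
  proof -
    have "distinct ?c1" "distinct ?c2" "distinct ?c3" "distinct ?c4"
      using r1(4) r2(4) r3(4) x by (auto intro!: distinct_row_column)
    moreover have "set ?c1 \<inter> set ?c2 = {}" "set ?c1 \<inter> set ?c3 = {}" "set ?c1 \<inter> set ?c4 = {}"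
        "set ?c2 \<inter> set ?c3 = {}" "set ?c3 \<inter> set ?c4 = {}"
      by (rule disjoint_row_columns; use x in simp)+
    moreover have False if v: "v \<in> set ?c2" "v \<in> set ?c4" for v
    proof -
      obtain k where k: "v = Suc i + k * x" "m \<le> k"
        using v(1) unfolding set_row_column by auto
      obtain k' where k': "v = Suc i + k' * x" "k' < m"
        using v(2) unfolding set_row_column r3(3) by auto
      have "k * x = k' * x" using k(1) k'(1) by linarith
      then show False using x k(2) k'(2) by simp
    qed
    then have "set ?c2 \<inter> set ?c4 = {}" by blast
    ultimately show ?thesis by (simp only: distinct_append set_append) blast
  qed
  moreover have "set ?p = {j + k * x |j k. i \<le> j \<and> j < x \<and> k < f j}" (is "?L = ?R")
  proof (intro equalityI subsetI)
    fix v assume "v \<in> ?R"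
    then obtain j k where v: "v = j + k * x" "i \<le> j" "j < x" "k < f j" by blast
    then consider "j = i" | "j = Suc i" | "j = Suc (Suc i)" using x by linarith
    then show "v \<in> ?L"
    proof cases
      case 2
      then have "v = Suc i + k * x" "k \<in> {m..<h1} \<or> k \<in> {..<m}" using v f by auto
      then show ?thesis using r3(3) by (auto simp: set_row_column)
    qed (use v f r1(3) r2(3) in \<open>auto simp: set_row_column\<close>)
  next
    have in_R: "j + k * x \<in> ?R" if "i \<le> j" "j < x" "k < f j" for j k
      using that by blast
    fix v assume "v \<in> ?L"
    then consider "v \<in> set ?c1" | "v \<in> set ?c2 \<or> v \<in> set ?c4" | "v \<in> set ?c3" by auto
    then show "v \<in> ?R"
    proof cases
      case 1
      then obtain k where "v = i + k * x" "k < h1" using r1(3) by (auto simp: set_row_column)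
      then show ?thesis using in_R[of i k] x f by simp
    next
      case 2
      then obtain k where "v = Suc i + k * x" "k \<in> {m..<h1} \<or> k \<in> {..<m}"
        unfolding set_row_column set_rev set_upt r3(3) by blast
      then show ?thesis using in_R[of "Suc i" k] x f m by auto
    next
      case 3
      then obtain k where "v = Suc (Suc i) + k * x" "k < h2"
        using r2(3) by (auto simp: set_row_column)
      then show ?thesis using in_R[of "Suc (Suc i)" k] x f by simp
    qed
  qed
  moreover have "hd ?p = i" using r1(1,2) by (simp add: hd_row_column)
  moreover have "?p \<noteq> []" using r1(1) by simp
  ultimately show ?thesis
    unfolding column_path_def
    by (intro exI[of _ ?p] exI[of _ "m1 + (h1 - m - 1) + m3 + m4"] conjI)
qed

lemma std_realizable_column_path:
  assumes p: "column_path x y f 0 n c" and f: "\<And>j. f j = (if j < T then Suc h else h)"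
    and "T < x" and size: "n + b + c + 1 = h * x + T"
  shows "std_realizable (replicate_mset n 1 + replicate_mset b x + replicate_mset c y)"
proof -
  obtain p m where p: "p \<noteq> []" "hd p = 0" "distinct p"
      "set p = {j + k * x |j k. j < x \<and> k < f j}"
      "lengths p = replicate_mset n 1 + replicate_mset m x + replicate_mset c y"
    using p by (auto simp: column_path_def)
  have "{j + k * x |j k. j < x \<and> k < f j} = {j + k * x |j k. j < T \<and> k < Suc h} \<union>
      {j + k * x |j k. T \<le> j \<and> j < x \<and> k < h}"
  proof (intro equalityI subsetI)
    fix v assume "v \<in> {j + k * x |j k. j < x \<and> k < f j}"
    then obtain j k where "v = j + k * x" "j < x" "k < f j" by blast
    then show "v \<in> {j + k * x |j k. j < T \<and> k < Suc h} \<union> {j + k * x |j k. T \<le> j \<and> j < x \<and> k < h}"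
      using f[of j] by (cases "j < T") auto
  next
    fix v assume "v \<in> {j + k * x |j k. j < T \<and> k < Suc h} \<union> {j + k * x |j k. T \<le> j \<and> j < x \<and> k < h}"
    then obtain j k where "v = j + k * x" "j < T \<and> k < Suc h \<or> T \<le> j \<and> j < x \<and> k < h" by blast
    then show "v \<in> {j + k * x |j k. j < x \<and> k < f j}"
      using f[of j] \<open>T < x\<close> by (intro CollectI exI[of _ j] exI[of _ k]) auto
  qed
  then have set: "set p = {..<h * x + T}" using grid_eq_lessThan[of T x h] \<open>T < x\<close> p(4) by simp
  then have len: "length p = h * x + T" using distinct_card[OF p(3)] by simp
  then have "std_path p" using p(1,2) set by (simp add: std_path_def)
  moreover have "m = b" using size_lengths[of p] len size unfolding p(5) by simp
  ultimately show ?thesis using p(5) unfolding std_realizable_def by blast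
qed

text \<open>Two paths hold multiples of \<open>t\<close>, a third one a remainder up to
  \<open>r\<close>. This reaches every \<open>g\<close> if \<open>r \<ge> t - 1\<close>. Otherwise
  \<open>h < 2 * t\<close>, so \<open>j2 = 0\<close>, and \<open>j1\<close> is nonzero only if
  \<open>h + d = 2 * t\<close>; then \<open>e = t - 2\<close>, and \<open>g = t - 1\<close> is the
  only gap.\<close>

lemma multiple_remainder_cases:
  fixes t h d g e j1 j2 :: nat
  assumes "3 \<le> t" "d \<le> 1" and h: "h = t + 1 + e"
    and j1: "Suc j1 * t \<le> h + d" "h + d < Suc (Suc j1) * t"
    and j2: "Suc j2 * t \<le> h" "h < Suc (Suc j2) * t"
    and r: "r = (if e < t then e else e - 1)" and g: "g \<le> (j1 + j2) * t + r"
  obtains k1 k2 l where "k1 \<le> j1" "k2 \<le> j2" "g = k1 * t + k2 * t + l" "l \<le> r"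
  | "d = 1" "h + d = 2 * t" "g = t - 1" "1 \<le> e"
proof -
  note case1 = that(1) and case2 = that(2)
  have split: thesis if "k \<le> j1 + j2" "k * t \<le> g" "g - k * t \<le> r" for k
  proof -
    have "k = min k j1 + (k - min k j1)" by simp
    then have "k * t = min k j1 * t + (k - min k j1) * t" by (metis add_mult_distrib)
    then have "g = min k j1 * t + (k - min k j1) * t + (g - k * t)" using that(2) by linarith
    moreover have "min k j1 \<le> j1" "k - min k j1 \<le> j2" using that(1) by linarith+
    ultimately show thesis using case1 that(3) by blast
  qed
  consider "g \<le> r" | "(j1 + j2) * t \<le> g" | "r < g" "g < (j1 + j2) * t" by linarith
  then show thesis
  proof cases
    case 1
    then show thesis using split[of 0] by simp
  next
    case 2
    then show thesis using split[of "j1 + j2"] g by simp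
  next
    case 3
    have "g div t < j1 + j2" using 3 assms(1) by (simp add: less_mult_imp_div_less)
    moreover have "g div t * t \<le> g" by simp
    moreover have rem: "g - g div t * t = g mod t" "g mod t < t"
      using assms(1) by (simp_all add: minus_div_mult_eq_mod)
    ultimately show thesis
    proof (cases "t - 1 \<le> r")
      case True
      then show thesis using split[of "g div t"] \<open>g div t < j1 + j2\<close> \<open>g div t * t \<le> g\<close> rem by linarith
    next
      case False
      then have e: "e + 2 \<le> t" "r = e" using r by (auto split: if_splits)
      then have "Suc j2 * t < 2 * t" using j2(1) h by linarith
      then have "Suc j2 < 2" by (rule mult_less_cancel2[THEN iffD1, THEN conjunct2])
      then have "j2 = 0" by simp
      then have "j1 \<noteq> 0" using 3 by (cases j1) auto
      then have "2 * t \<le> Suc j1 * t" by (intro mult_le_mono1) simp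
      then have "d = 1" "h + d = 2 * t" "e + 2 = t" using j1(1) h e \<open>d \<le> 1\<close> by linarith+
      then have "Suc j1 * t < 3 * t" using j1(1) assms(1) by linarith
      then have "Suc j1 < 3" by (rule mult_less_cancel2[THEN iffD1, THEN conjunct2])
      then have "j1 = 1" using \<open>j1 \<noteq> 0\<close> by simp
      then have "g = t - 1" using 3 e \<open>j2 = 0\<close> \<open>e + 2 = t\<close> by simp
      then show thesis using case2 \<open>d = 1\<close> \<open>h + d = 2 * t\<close> \<open>e + 2 = t\<close> assms(1) by simp
    qed
  qed
qed

text \<open>In general the third column is entered at its top. The first and third columns hold
  multiples of \<open>t\<close>, the lower \<open>h - 1\<close> vertices of the second one the
  remainder. Two exceptional situations get paths of their own.\<close>

lemma column_path_triple_exists: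
  fixes t h d g e j1 j2 :: nat
  assumes "odd t" "3 \<le> t" "d \<le> 1" and h: "h = t + 1 + e"
    and j1: "Suc j1 * t \<le> h + d" "h + d < Suc (Suc j1) * t"
    and j2: "Suc j2 * t \<le> h" "h < Suc (Suc j2) * t"
    and r: "r = (if e < t then e else e - 1)" and g: "g \<le> max 1 ((j1 + j2) * t + r)"
    and f: "f i = h + d" "f (Suc i) = h + d" "f (Suc (Suc i)) = h" and x: "x = i + 3"
  shows "column_path x (t * x) f i 3 g"
proof (cases "e = 0 \<and> g = 1")
  case True
  \<comment> \<open>The path \<open>0, t, t - 1, ..., 1\<close> has one edge of length
    \<open>t\<close> and ends at \<open>1\<close>, so only the bottom of the second column is left
    for the return.\<close>
  have "row_path t (Suc t) 1 (0 # rev [1..<Suc t])"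
  proof -
    have "[1..<Suc t] = map Suc [0..<t]" by (simp add: map_Suc_upt del: upt_Suc)
    then have "lengths [1..<Suc t] = replicate_mset (t - 1) 1"
      by (simp only: lengths_map_Suc lengths_upt)
    then have "lengths (0 # rev [1..<Suc t]) = add_mset t (replicate_mset (t - 1) 1)"
      using assms(2) lengths_append[of "[0]" "rev [1..<Suc t]"]
      by (simp add: hd_rev linear_length_def last_upt del: upt_Suc)
    moreover have "std_path (0 # rev [1..<Suc t])"
      by (auto simp: std_path_def simp del: upt_Suc)
    ultimately show ?thesis
      unfolding row_path_def by (intro conjI exI[of _ "t - 1"]) (simp_all del: upt_Suc)
  qed
  moreover have "last (0 # rev [1..<Suc t]) = 1" using assms(2) by (simp add: last_rev del: upt_Suc)
  moreover have "row_path t (h + d) 0 [0..<h + d]" by (rule row_path_upt) (simp add: h)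
  moreover have "last [0..<h + d] = h + d - 1" using h by simp
  moreover have "row_path t 1 0 [0..<1]" by (rule row_path_upt) simp
  ultimately show ?thesis
    using column_path_triple[of t "h + d" 0 "[0..<h + d]" h 1 "0 # rev [1..<Suc t]" 1 0 "[0..<1]" f i x]
      True f x h assms(2) by simp
next
  case False
  have "g \<le> (j1 + j2) * t + r"
    using False g r assms(2) by (cases "g \<le> 1") (auto simp: le_Suc_eq)
  have top: "h - 1 < h + d" "Suc (h - 1) = h" "Suc (h + d - 1) = h + d" using h by auto
  from multiple_remainder_cases[OF assms(2-9) \<open>g \<le> (j1 + j2) * t + r\<close>]
  show ?thesis
  proof cases
    case (1 k1 k2 l)
    have "Suc k1 * t \<le> Suc j1 * t" "Suc k2 * t \<le> Suc j2 * t" using 1 by (intro mult_le_mono1, simp)+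
    then have le: "Suc k1 * t \<le> Suc (h + d - 1)" "Suc k2 * t \<le> Suc (h - 1)"
      unfolding top using j1 j2 by linarith+
    obtain r1 where r1: "row_path t (h + d) (k1 * t) r1" "last r1 = h + d - 1"
      using row_path_multiple[OF \<open>odd t\<close> le(1)] unfolding top by blast
    obtain r2 where r2: "row_path t h (k2 * t) r2" "last r2 = h - 1"
      using row_path_multiple[OF \<open>odd t\<close> le(2)] unfolding top by blast
    have "l < t \<and> l + t \<le> h - 1 \<or> l + t + 1 \<le> h - 1"
    proof (cases "e < t")
      case True
      then have "l \<le> e" using 1(4) r by simp
      then show ?thesis using True h by linarith
    next
      case False
      then have "l \<le> e - 1" using 1(4) r by simp
      then show ?thesis using False h assms(2) by linarith
    qed
    then obtain r3 where r3: "row_path t (h - 1) l r3"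
      using row_path_exists[OF \<open>odd t\<close>] by blast
    show ?thesis
      using column_path_triple[OF r1 r2 r3 top(1) f x] 1(3) by simp
  next
    case 2
    \<comment> \<open>In the gap the first column takes two edges of length \<open>t\<close>, the
      third none, and the rest of the second \<open>t - 3\<close>.\<close>
    have "crossing t (1 * t + 1 + (t - 2)) (t - 1 + (t - 2))"
      by (rule crossing_add[OF crossing_link[OF \<open>odd t\<close>]]) simp
    moreover have "1 * t + 1 + (t - 2) = h + d - 1" using 2 assms(2) by linarith
    ultimately have "crossing t (h + d - 1) (t - 1 + (t - 2))" by (simp only:)
    moreover have "t - 1 + (t - 2) + 2 = h + d - 1" using 2 assms(2) by linarith
    ultimately obtain r1 where r1: "row_path t (h + d) 2 r1" "last r1 = h + d - 1"
      using crossing_row_path[of t "h + d - 1"] unfolding top by blast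
    obtain r2 where r2: "row_path t h (0 * t) r2" "last r2 = h - 1"
      using row_path_multiple[OF \<open>odd t\<close>, of 0 "h - 1"] h unfolding top by auto
    have g_eq: "2 + 0 * t + (t - 3) = g" using 2 assms(2) by simp
    have "t - 3 < t \<and> t - 3 + t \<le> h - 1" using 2 assms(2) by linarith
    then obtain r3 where r3: "row_path t (h - 1) (t - 3) r3"
      using row_path_exists[OF \<open>odd t\<close>] by blast
    show ?thesis
      using column_path_triple[OF r1 r2 r3 top(1) f x] unfolding g_eq .
  qed
qed

section \<open>Filling all columns when \<open>y\<close> is an odd multiple of
  \<open>x\<close>\<close>

lemma column_path_all:
  fixes e :: nat
  assumes "odd t" and top: "column_path x (t * x) f (2 * k1 + 2 * k2) n l"
    and f1: "\<And>j. j < 2 * k1 \<Longrightarrow> f j = t + 2 + e"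
    and f2: "\<And>j. 2 * k1 \<le> j \<Longrightarrow> j < 2 * k1 + 2 * k2 \<Longrightarrow> f j = t + 1 + e"
    and "2 * k1 + 2 * k2 < x" "g \<le> k1 * (e + 1) + k2 * e"
  shows "column_path x (t * x) f 0 (n + 2 * k1 + 2 * k2) (l + 2 * g)"
proof -
  define g2 where "g2 = min g (k2 * e)"
  have "column_path x (t * x) f (2 * k1) (n + 2 * k2) (l + 2 * g2)"
    using assms by (intro column_path_pairs[where i = "2 * k1" and k = k2 and e = e]) (auto simp: g2_def)
  then have "column_path x (t * x) f 0 (n + 2 * k2 + 2 * k1) (l + 2 * g2 + 2 * (g - g2))"
    using assms by (intro column_path_pairs[where i = 0 and k = k1 and e = "e + 1"]) (auto simp: g2_def)
  moreover have "l + 2 * g2 + 2 * (g - g2) = l + 2 * g" by (simp add: g2_def)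
  ultimately show ?thesis by (simp add: ac_simps)
qed

text \<open>The columns have height \<open>t + 1 + e\<close>, the first \<open>T\<close> one more.
  As \<open>T\<close> and \<open>x - 1 - T\<close> are even, all columns but the last are paired,
  each pair with equal heights. The pairs take an even number of the long edges, the last column
  takes the rest.\<close>

lemma std_realizable_multiple_even:
  fixes x t b c :: nat
  assumes x: "odd x" and t: "odd t" "3 \<le> t" and b: "t * x \<le> b" and T: "even ((b + c) mod x)"
  shows "std_realizable (replicate_mset (x - 1) 1 + replicate_mset b x + replicate_mset c (t * x))"
proof -
  have "0 < x" using x by (rule odd_pos)
  define T where "T = (b + c) mod x"
  have "T < x" using \<open>0 < x\<close> by (simp add: T_def)
  have "t * x \<le> b + c" using b by simp
  then have "t \<le> (b + c) div x" using \<open>0 < x\<close> by (simp add: less_eq_div_iff_mult_less_eq)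
  then obtain e where "(b + c) div x = t + e" using le_Suc_ex by blast
  then have bc: "b + c = (t + e) * x + T" using div_mult_mod_eq[of "b + c" x] by (simp add: T_def)
  obtain k1 where k1: "T = 2 * k1" using assms(5) by (auto simp: T_def elim: evenE)
  have "even (x - 1 - T)" using x \<open>T < x\<close> k1 by simp
  then obtain k2 where k2: "x - 1 - T = 2 * k2" by (elim evenE)
  then have x_eq: "x = 2 * k1 + 2 * k2 + 1" using \<open>T < x\<close> k1 by simp
  define f where "f = (\<lambda>j. if j < T then Suc (t + 1 + e) else t + 1 + e)"
  define K where "K = k1 * (e + 1) + k2 * e"
  define g where "g = min K (c div 2)"
  define l where "l = c - 2 * g"
  have "c \<le> 2 * K + e"
  proof -
    have "(t + e) * x + T = t * x + 2 * K + e"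
      unfolding x_eq k1 K_def by (simp add: algebra_simps)
    then show ?thesis using b bc by linarith
  qed
  \<comment> \<open>Either the pairs take all long edges up to parity, or they are full and at most
    \<open>e\<close> remain.\<close>
  then have "l \<le> 1 \<or> l \<le> e" unfolding l_def g_def by linarith
  then obtain r where r: "row_path t (t + 1 + e) l r"
    using row_path_exists[OF t(1), of l "t + 1 + e"] t(2) by fastforce
  have "f (x - 1) = t + 1 + e" using \<open>T < x\<close> by (simp add: f_def)
  then have "column_path x (t * x) f (x - 1) 0 l" using column_path_single[OF r] \<open>0 < x\<close> by blast
  moreover have "x - 1 = 2 * k1 + 2 * k2" using x_eq by simp
  ultimately have "column_path x (t * x) f (2 * k1 + 2 * k2) 0 l" by simp
  then have "column_path x (t * x) f 0 (0 + 2 * k1 + 2 * k2) (l + 2 * g)"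
    by (rule column_path_all[OF t(1), where e = e]) (use x_eq k1 in \<open>auto simp: f_def g_def K_def\<close>)
  moreover have "0 + 2 * k1 + 2 * k2 = x - 1" "l + 2 * g = c"
    using x_eq by (auto simp: l_def g_def)
  ultimately have "column_path x (t * x) f 0 (x - 1) c" by simp
  then show ?thesis
    by (rule std_realizable_column_path[where h = "t + 1 + e" and T = T])
      (use bc \<open>T < x\<close> in \<open>auto simp: f_def algebra_simps\<close>)
qed

text \<open>One more edge of length 1 makes the number \<open>T\<close> of tall columns even. The
  last three columns together use three ones, and the other columns are paired.\<close>

lemma std_realizable_multiple_odd:
  fixes x t b c :: nat
  assumes x: "odd x" "3 \<le> x" and t: "odd t" "3 \<le> t" and b: "t * x + 2 * t \<le> b + 3"
    and T: "odd ((b + c) mod x)"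
  shows "std_realizable (replicate_mset x 1 + replicate_mset b x + replicate_mset c (t * x))"
proof -
  define T where "T = Suc ((b + c) mod x)"
  have "even T" using assms(6) by (simp add: T_def)
  have "T \<le> x" using x by (simp add: T_def Suc_le_eq)
  then have "T < x" using \<open>even T\<close> x(1) by (metis le_neq_implies_less)
  have "t * x \<le> b + c" using b t by simp
  then have "t \<le> (b + c) div x" using x by (simp add: less_eq_div_iff_mult_less_eq)
  then obtain e where "(b + c) div x = t + e" using le_Suc_ex by blast
  then have bc: "b + c + 1 = (t + e) * x + T" using div_mult_mod_eq[of "b + c" x] by (simp add: T_def)
  \<comment> \<open>\<open>d = 1\<close> means that all columns but the last are tall, so the triple
    begins with two tall ones; otherwise it consists of short columns.\<close>
  define d where "d = (if Suc T = x then 1 else 0::nat)"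
  have "2 * d \<le> T" using x(2) by (auto simp: d_def)
  then have "even (T - 2 * d)" using \<open>even T\<close> by simp
  then obtain k1 where "T - 2 * d = 2 * k1" by (elim evenE)
  then have k1: "T = 2 * k1 + 2 * d" using \<open>2 * d \<le> T\<close> by simp
  have "even (x - T - 1)" using x \<open>even T\<close> \<open>T < x\<close> by simp
  then obtain k where "x - T - 1 = 2 * k" by (elim evenE)
  then have k: "x = T + 2 * k + 1" using \<open>T < x\<close> by simp
  define k2 where "k2 = k - 1"
  have d_k: "d = (if k = 0 then 1 else 0)" using k by (simp add: d_def)
  have "d = 1 \<Longrightarrow> k2 = 0" unfolding k2_def using d_k by (cases "k = 0") simp_all
  have x_eq: "x = 2 * k1 + 2 * k2 + 3"
  proof (cases k)
    case 0
    then have "d = 1" "k2 = 0" using d_k by (simp_all add: k2_def)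
    then show ?thesis using k k1 0 by linarith
  next
    case (Suc k')
    then have "d = 0" "k = Suc k2" using d_k by (simp_all add: k2_def)
    then show ?thesis using k k1 by linarith
  qed
  define h where "h = t + 1 + e"
  define f where "f = (\<lambda>j. if j < T then Suc h else h)"
  define K where "K = k1 * (e + 1) + k2 * e"
  define g where "g = min K (c div 2)"
  define l where "l = c - 2 * g"
  define r where "r = (if e < t then e else e - 1)"
  have "0 < t" "t \<le> h" using t by (auto simp: h_def)
  then have "1 \<le> h div t" "1 \<le> (h + d) div t"
    using div_le_mono[of t h t] div_le_mono[of t "h + d" t] by auto
  then obtain j1 j2 where "(h + d) div t = Suc j1" "h div t = Suc j2"
    by (metis Suc_le_D One_nat_def)
  then have j1: "Suc j1 * t \<le> h + d" "h + d < Suc (Suc j1) * t"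
    and j2: "Suc j2 * t \<le> h" "h < Suc (Suc j2) * t"
    using \<open>0 < t\<close> dividend_less_div_times[of t "h + d"] dividend_less_div_times[of t h]
      div_times_less_eq_dividend[of "h + d" t] div_times_less_eq_dividend[of h t]
    by (simp_all add: algebra_simps)
  have "d \<le> 1" by (simp add: d_def)
  have c_le: "c + 2 * t \<le> 2 * K + 3 * e + 2 * d + 2"
  proof -
    have "(t + e) * x + T = t * x + 2 * K + 3 * e + 2 * d"
      unfolding x_eq k1 K_def by (simp add: algebra_simps)
    then show ?thesis using b bc by linarith
  qed
  \<comment> \<open>That \<open>h\<close> and \<open>h + d\<close> lie below the next multiples of
    \<open>t\<close> gives this up to one if \<open>d = 1\<close>. The missing one comes from
    comparing the multiples: only \<open>j1 = j2\<close> and \<open>j1 = Suc j2\<close> can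
    occur.\<close>
  have "2 * h + 2 + 2 * d \<le> j1 * t + j2 * t + 4 * t"
  proof (cases "d = 0")
    case True
    then show ?thesis using j1 j2 by simp
  next
    case False
    then have "d = 1" using \<open>d \<le> 1\<close> by simp
    consider "j1 < j2" | "j1 = j2" | "j1 = Suc j2" | "Suc (Suc j2) \<le> j1" by linarith
    then show ?thesis
    proof cases
      case 1
      then have "Suc (Suc j1) * t \<le> Suc j2 * t" by (intro mult_le_mono1) simp
      then show ?thesis using j1 j2 by linarith
    next
      case 2
      then show ?thesis using j1 \<open>d = 1\<close> by simp
    next
      case 3
      then show ?thesis using j1 j2 \<open>d = 1\<close> t(2) by simp
    next
      case 4
      then have "Suc (Suc (Suc j2)) * t \<le> Suc j1 * t" by (intro mult_le_mono1) simp
      then show ?thesis using j1 j2 \<open>d = 1\<close> t(2) by simp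
    qed
  qed
  then have "c \<le> 2 * K + ((j1 + j2) * t + r)"
    using c_le unfolding add_mult_distrib r_def h_def by (auto split: if_splits)
  then have "l \<le> max 1 ((j1 + j2) * t + r)" unfolding l_def g_def by linarith
  moreover define i where "i = 2 * k1 + 2 * k2"
  have "f i = h + d" "f (Suc i) = h + d" "f (Suc (Suc i)) = h" "x = i + 3"
    using k1 x_eq k d_k unfolding f_def i_def by (cases k; simp add: k2_def)+
  ultimately have "column_path x (t * x) f i 3 l"
    using column_path_triple_exists[OF t \<open>d \<le> 1\<close> h_def j1 j2 r_def] by blast
  then have "column_path x (t * x) f 0 (3 + 2 * k1 + 2 * k2) (l + 2 * g)"
    unfolding i_def
    by (rule column_path_all[OF t(1), where e = e])
      (use x_eq k1 \<open>d = 1 \<Longrightarrow> k2 = 0\<close> \<open>d \<le> 1\<close> in \<open>auto simp: f_def g_def K_def h_def le_Suc_eq\<close>)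
  moreover have "3 + 2 * k1 + 2 * k2 = x" "l + 2 * g = c"
    using x_eq by (auto simp: l_def g_def)
  ultimately have "column_path x (t * x) f 0 x c" by simp
  then show ?thesis
    by (rule std_realizable_column_path[where h = h and T = T])
      (use bc \<open>T < x\<close> in \<open>auto simp: f_def h_def algebra_simps\<close>)
qed

lemma realizable_multiple:
  fixes x t a b c :: nat
  assumes x: "odd x" "3 \<le> x" and t: "odd t" "3 \<le> t" and b: "t * x + 2 * t \<le> b + 3" and "x \<le> a"
  shows "has_linear_realization (replicate_mset a 1 + replicate_mset b x + replicate_mset c (t * x))"
proof -
  obtain n where "n \<le> x"
    "std_realizable (replicate_mset n 1 + replicate_mset b x + replicate_mset c (t * x))"
  proof (cases "even ((b + c) mod x)")
    case True
    then show ?thesis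
      using that[of "x - 1"] std_realizable_multiple_even[OF x(1) t _ True] b t(2) by simp
  next
    case False
    then show ?thesis using that[of x] std_realizable_multiple_odd[OF x t b False] by simp
  qed
  then have "std_realizable (replicate_mset a 1 + (replicate_mset b x + replicate_mset c (t * x)))"
    using std_realizable_add_ones[of n _ a] \<open>x \<le> a\<close> by (simp add: add.assoc)
  then show ?thesis using std_realizable_imp by (simp add: add.assoc)
qed

theorem theorem1p8:
  fixes x y a b c :: nat and L :: "nat multiset"
  assumes "1 < x" and "x < y"
    and "L = replicate_mset a 1 + replicate_mset b x + replicate_mset c y"
  shows "(int a \<ge> int x + int y - 1 \<longrightarrow> has_linear_realization L)
    \<and> (int a \<ge> int x + int y - 2 \<and> (x = 3 \<or> even x) \<longrightarrow> has_linear_realization L)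
    \<and> (int a \<ge> 4 * int x - 3 \<and> odd x \<and> int y > 2 * int x - 2
         \<and> int b \<ge> int y - 2 * int x + 2 \<longrightarrow> has_linear_realization L)
    \<and> (\<forall>t::nat. a \<ge> x \<and> y = t * x \<and> odd x \<and> odd t
         \<and> int b \<ge> int t * int x + 2 * int t - 3 \<longrightarrow> has_linear_realization L)
    \<and> (a \<ge> 7 \<and> x = 3 \<and> int b \<ge> int y - 4 \<longrightarrow> has_linear_realization L)"
proof (intro conjI impI allI)
  have odd_ge_3: "3 \<le> x" if "odd x" using that \<open>1 < x\<close> by (cases "x = 2") auto
  have suffice: "ones_suffice x (x - 1)" if "x = 3 \<or> even x"
    using that ones_suffice_3 ones_suffice_even[of x] \<open>1 < x\<close> by auto
  show case2: "has_linear_realization L" if "int a \<ge> int x + int y - 2 \<and> (x = 3 \<or> even x)"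
    unfolding assms(3)
    by (rule realizable_two_blocks[OF suffice]) (use that assms in auto)
  show "has_linear_realization L" if "int a \<ge> int x + int y - 1"
  proof (cases "odd x")
    case True
    then show ?thesis unfolding assms(3)
      by (intro realizable_two_blocks[OF ones_suffice_odd]) (use that assms in auto)
  qed (use case2 that in auto)
  \<comment> \<open>The threshold \<open>k = x\<close> turns \<open>2 * x - 3 + 2 * k\<close> into
    \<open>4 * x - 3\<close>; for \<open>x = 3\<close> the threshold \<open>k = 2\<close> turns it
    into 7.\<close>
  show "has_linear_realization L"
    if "int a \<ge> 4 * int x - 3 \<and> odd x \<and> int y > 2 * int x - 2 \<and> int b \<ge> int y - 2 * int x + 2"
    unfolding assms(3)
    by (rule realizable_few_ones[where k = x]) (use that assms odd_ge_3 ones_suffice_odd in auto)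
  show "has_linear_realization L" if "a \<ge> 7 \<and> x = 3 \<and> int b \<ge> int y - 4"
    unfolding assms(3)
    by (rule realizable_few_ones[where k = 2]) (use that assms ones_suffice_3 in auto)
  fix t :: nat
  assume t: "a \<ge> x \<and> y = t * x \<and> odd x \<and> odd t \<and> int b \<ge> int t * int x + 2 * int t - 3"
  \<comment> \<open>An odd \<open>t\<close> below 3 is 1, which would give
    \<open>y = x\<close>.\<close>
  have "3 \<le> t"
  proof (rule ccontr)
    assume "\<not> 3 \<le> t"
    moreover have "odd t" using t by blast
    ultimately have "t = 1" by presburger
    then show False using t \<open>x < y\<close> by simp
  qed
  have "int (t * x + 2 * t) \<le> int (b + 3)" using t by simp
  then have "t * x + 2 * t \<le> b + 3" by linarith
  then show "has_linear_realization L"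
    using realizable_multiple[of x t b a c] t odd_ge_3 \<open>3 \<le> t\<close> assms(3) by simp
qed

end
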